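(* Let $\beta>0$, $\lambda\in\mathbb R$ and define $A^{RS}(\beta,\lambda)=\inf_{\bar q\in\mathcal D_{\beta,\lambda}}\tilde A(\beta,\lambda,\bar q)$. Then $$A^{RS}(\beta,\lambda)=\begin{cases}-\frac12\log(1-\lambda), & \lambda<1,\ \beta\le1-\lambda,\\[2pt] -\frac12\log\beta+\frac{\beta\bar q^*}{2}+\frac{\beta^2(\bar q^* )^2}{4}, & \beta>1-\lambda,\end{cases}\qquad \bar q^*=\frac{\beta-(1-\lambda)}{\beta^2},$$ the infimum being attained at $\bar q=0$ in the first case and at $\bar q=\bar q^*$ in the second, and for every $N\ge1$ $$A_N(\beta,\lambda)\le A^{RS}(\beta,\lambda).$$
   Context: For $N\ge 1$, $\beta>0$, $\lambda\in\mathbb{R}$, let $J=(J_{ij})_{i,j=1}^N$ be $N^2$ i.i.d. standard Gaussian $\mathcal N(0,1)$ random variables (one for each ordered pair $(i,j)$, diagonal pairs included). $\mathbb E_z$ denotes integration with respect to the standard Gaussian measure $(2\pi)^{-N/2}e^{-\|z\|^2/2}dz$ on $\mathbb R^N$, and $\mathbb E$ denotes expectation with respect to the disorder. The (zero-field) partition function is $$Z_N(\beta,\lambda;J)=\mathbb E_z\exp\Big(\frac{\beta}{\sqrt{2N}}\sum_{i,j=1}^N J_{ij}z_iz_j-\frac{\beta^2}{4N}\Big(\sum_{i=1}^N z_i^2\Big)^2+\frac{\lambda}{2}\sum_{i=1}^N z_i^2\Big),$$ and $A_N(\beta,\lambda)=\frac1N\mathbb E\log Z_N(\beta,\lambda;J)$.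 Further, $\mathcal D_{\beta,\lambda}=\{\bar q\ge0:\ 1-\lambda+\beta^2\bar q>0\}$, $\sigma=(1-\lambda+\beta^2\bar q)^{-1/2}$, and $\tilde A(\beta,\lambda,\bar q)=\log\sigma+\frac12\beta^2\bar q\sigma^2+\frac{\beta^2}{4}\bar q^2$. *)

theory Defs
  imports "HOL-Probability.Probability"
begin

definition std_gauss :: "real measure" where
  "std_gauss = density lborel std_normal_density"

definition gauss_vec :: "nat \<Rightarrow> (nat \<Rightarrow> real) measure" where
  "gauss_vec N = PiM {..<N} (\<lambda>_. std_gauss)"

definition disorder :: "nat \<Rightarrow> (nat \<times> nat \<Rightarrow> real) measure" where
  "disorder N = PiM ({..<N} \<times> {..<N}) (\<lambda>_. std_gauss)"

definition Z_N :: "nat \<Rightarrow> real \<Rightarrow> real \<Rightarrow> (nat \<times> nat \<Rightarrow> real) \<Rightarrow> real" where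
  "Z_N N \<beta> lam J = (\<integral>z. exp (\<beta> / sqrt (2 * real N) * (\<Sum>i<N. \<Sum>j<N. J (i, j) * z i * z j)
        - \<beta>\<^sup>2 / (4 * real N) * (\<Sum>i<N. (z i)\<^sup>2)\<^sup>2 + lam / 2 * (\<Sum>i<N. (z i)\<^sup>2)) \<partial>gauss_vec N)"

definition A_N :: "nat \<Rightarrow> real \<Rightarrow> real \<Rightarrow> real" where
  "A_N N \<beta> lam = (1 / real N) * (\<integral>J. ln (Z_N N \<beta> lam J) \<partial>disorder N)"

definition D_set :: "real \<Rightarrow> real \<Rightarrow> real set" where
  "D_set \<beta> lam = {q. q \<ge> 0 \<and> 1 - lam + \<beta>\<^sup>2 * q > 0}"

definition sigma_RS :: "real \<Rightarrow> real \<Rightarrow> real \<Rightarrow> real" where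
  "sigma_RS \<beta> lam q = 1 / sqrt (1 - lam + \<beta>\<^sup>2 * q)"

definition A_tilde :: "real \<Rightarrow> real \<Rightarrow> real \<Rightarrow> real" where
  "A_tilde \<beta> lam q = ln (sigma_RS \<beta> lam q) + 1/2 * \<beta>\<^sup>2 * q * (sigma_RS \<beta> lam q)\<^sup>2
      + \<beta>\<^sup>2 / 4 * q\<^sup>2"

definition A_RS :: "real \<Rightarrow> real \<Rightarrow> real" where
  "A_RS \<beta> lam = Inf (A_tilde \<beta> lam ` D_set \<beta> lam)"

end

(* The bound A_N <= A_tilde q holds for every admissible q by Guerra's interpolation between
   the Gaussian Hamiltonian H(z), with covariance beta^2/(2N) (z.w)^2, and the random external
   field beta sqrt(q) g.z, with covariance beta^2 q (z.w).  The difference of the covariances is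
   beta^2/(2N) (z.w - qN)^2 - beta^2 q^2 N/2, and along the path cos(t) field + sin(t) H Gaussian
   integration by parts shows that the expected log-partition function moves only through this
   difference, so that the square can be dropped.  The quartic term of Z_N is exactly half the
   variance of H.  To differentiate freely, the spins are first replaced by simple functions of
   them, which turns the partition functions into finite sums; the quartic term (for H) and
   admissibility of q (for the field) give the domination needed to remove this cutoff.  The field
   model factorises over the sites.  In the variable u = 1 - lambda + beta^2 q the derivative of
   A_tilde has the sign of (u - (1 - lambda)) (u - beta), which locates the minimum. *)

theory Submission
  imports Defs
begin

section \<open>Gaussian integration by parts\<close>

text \<open>Each endpoint carries its own counterterm of half its variance. Integration by parts
  produces overlaps of a configuration with itself, and these enter with a plus sign, whereas the
  covariance difference is bounded only from below; the counterterms cancel them at every time. For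
  the field the counterterm is \<open>\<beta>\<^sup>2 * q / 2\<close> times the squared norm: it
  shifts \<open>lam\<close> to \<open>lam - \<beta>\<^sup>2 * q\<close>, so that the one-site
  integrals converge for \<open>1 - lam + \<beta>\<^sup>2 * q > 0\<close>. The path uses sine and
  cosine because the usual weights, the square roots of \<open>t\<close> and \<open>1 - t\<close>,
  have unbounded derivatives at the ends, while here one dominating function serves all
  \<open>t\<close>. The delicate point in removing the cutoff is the logarithm, which also needs
  partition functions bounded away from zero. This comes from a ball of positive Gaussian mass on
  which both energies are bounded below. The simple functions are at most the spins in modulus, so
  all these bounds survive the cutoff.\<close>

lemma has_real_derivative_integral:
  fixes F F' :: "real \<Rightarrow> 'a \<Rightarrow> real"
  assumes deriv: "\<And>t x. x \<in> space M \<Longrightarrow> ((\<lambda>t. F t x) has_real_derivative F' t x) (at t)"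
    and F: "\<And>t. integrable M (F t)"
    and F'[measurable]: "\<And>t. F' t \<in> borel_measurable M"
    and g: "integrable M g"
    and bound: "\<And>t x. x \<in> space M \<Longrightarrow> \<bar>F' t x\<bar> \<le> g x"
  shows "((\<lambda>t. \<integral>x. F t x \<partial>M) has_real_derivative (\<integral>x. F' t x \<partial>M)) (at t)"
  unfolding has_field_derivative_iff tendsto_at_iff_sequentially
proof safe
  fix X :: "nat \<Rightarrow> real"
  assume X: "\<forall>i. X i \<in> UNIV - {t}" and lim: "X \<longlonglongrightarrow> t"
  have [measurable]: "F t \<in> borel_measurable M" for t
    using F by auto
  have "(\<lambda>i. \<integral>x. (F (X i) x - F t x) / (X i - t) \<partial>M) \<longlonglongrightarrow> (\<integral>x. F' t x \<partial>M)"
  proof (rule integral_dominated_convergence[OF _ _ g])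
    show "AE x in M. (\<lambda>i. (F (X i) x - F t x) / (X i - t)) \<longlonglongrightarrow> F' t x"
    proof (rule AE_I2)
      fix x assume "x \<in> space M"
      from deriv[OF this, of t] X lim
      show "(\<lambda>i. (F (X i) x - F t x) / (X i - t)) \<longlonglongrightarrow> F' t x"
        unfolding has_field_derivative_iff tendsto_at_iff_sequentially comp_def by blast
    qed
    show "AE x in M. norm ((F (X i) x - F t x) / (X i - t)) \<le> g x" for i
    proof (rule AE_I2)
      fix x assume x: "x \<in> space M"
      \<comment> \<open>The mean value inequality turns the bound on \<open>F'\<close>, uniform in
        \<open>t\<close>, into a bound on difference quotients, which is what dominated convergence
        needs.\<close>
      have "norm (F (X i) x - F t x) \<le> g x * norm (X i - t)"
        by (rule field_differentiable_bound[where S = UNIV and f' = "\<lambda>t. F' t x"])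
          (use deriv[OF x] bound[OF x] in \<open>auto intro: has_field_derivative_at_within\<close>)
      then show "norm ((F (X i) x - F t x) / (X i - t)) \<le> g x"
        using X by (auto simp: divide_simps abs_mult)
    qed
  qed measurable
  then show "((\<lambda>y. ((\<integral>x. F y x \<partial>M) - (\<integral>x. F t x \<partial>M)) / (y - t)) \<circ> X) \<longlonglongrightarrow> (\<integral>x. F' t x \<partial>M)"
    using F by (simp add: comp_def)
qed

section \<open>The standard Gaussian measure and integration by parts in its products\<close>

lemma sets_std_gauss[measurable_cong, simp]: "sets std_gauss = sets borel"
  by (simp add: std_gauss_def)

lemma space_std_gauss[simp]: "space std_gauss = UNIV"
  by (simp add: std_gauss_def)

lemma prob_space_std_gauss: "prob_space std_gauss"
  unfolding std_gauss_def by (rule prob_space_normal_density) simp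

interpretation std_gauss: prob_space std_gauss
  by (rule prob_space_std_gauss)

interpretation std_gauss_prod: product_prob_space "\<lambda>_. std_gauss" I for I
  by standard

lemma integrable_std_gauss_power: "integrable std_gauss (\<lambda>x. x ^ k)"
  unfolding std_gauss_def by (rule integrable_std_normal_distribution_moment)

lemma integral_std_gauss:
  "f \<in> borel_measurable borel \<Longrightarrow> (\<integral>x. f x \<partial>std_gauss) = (\<integral>x. std_normal_density x * f x \<partial>lborel)"
  unfolding std_gauss_def by (subst integral_density) auto

lemma integrable_std_gauss:
  "f \<in> borel_measurable borel \<Longrightarrow>
    integrable std_gauss f \<longleftrightarrow> integrable lborel (\<lambda>x. std_normal_density x * f x)" for f :: "real \<Rightarrow> real"
  unfolding std_gauss_def by (subst integrable_density) auto

lemma std_normal_density_tendsto_0: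
  "(std_normal_density \<longlongrightarrow> 0) at_top" "(std_normal_density \<longlongrightarrow> 0) at_bot"
proof -
  have "filterlim (\<lambda>x::real. x\<^sup>2) at_top at_top" "filterlim (\<lambda>x::real. x\<^sup>2) at_top at_bot"
    using filterlim_pow_at_top[of 2 "\<lambda>x::real. x" at_top] filterlim_pow_at_bot_even[of 2 "\<lambda>x::real. x" at_bot]
    by (auto simp: filterlim_ident)
  then have "filterlim (\<lambda>x::real. (1/2) * x\<^sup>2) at_top at_top" "filterlim (\<lambda>x::real. (1/2) * x\<^sup>2) at_top at_bot"
    using filterlim_tendsto_pos_mult_at_top[OF tendsto_const, of "1/2" "\<lambda>x::real. x\<^sup>2"] by simp_all
  then have *: "filterlim (\<lambda>x::real. - x\<^sup>2 / 2) at_bot at_top" and **: "filterlim (\<lambda>x::real. - x\<^sup>2 / 2) at_bot at_bot"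
    by (auto simp: filterlim_uminus_at_top)
  have "((\<lambda>x. (1 / sqrt (2 * pi)) * exp (- x\<^sup>2 / 2)) \<longlongrightarrow> (1 / sqrt (2 * pi)) * 0) at_top"
    "((\<lambda>x. (1 / sqrt (2 * pi)) * exp (- x\<^sup>2 / 2)) \<longlongrightarrow> (1 / sqrt (2 * pi)) * 0) at_bot"
    using filterlim_compose[OF exp_at_bot *] filterlim_compose[OF exp_at_bot **]
    by (intro tendsto_mult tendsto_const; simp)+
  then show "(std_normal_density \<longlongrightarrow> 0) at_top" "(std_normal_density \<longlongrightarrow> 0) at_bot"
    by (auto simp: std_normal_density_def[abs_def])
qed

text \<open>The standard normal density has logarithmic derivative \<open>- x\<close>, so the
  density times \<open>f' x - x * f x\<close> is the exact derivative of the density times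
  \<open>f\<close>. Its integral over the line is a difference of boundary values, and these vanish
  because \<open>f\<close> is bounded.\<close>

lemma std_gauss_integral_by_parts:
  fixes f f' :: "real \<Rightarrow> real"
  assumes deriv: "\<And>x. (f has_real_derivative f' x) (at x)"
    and cont: "continuous_on UNIV f'"
    and bound: "\<And>x. \<bar>f x\<bar> \<le> B" "\<And>x. \<bar>f' x\<bar> \<le> B'"
  shows "(\<integral>x. x * f x \<partial>std_gauss) = (\<integral>x. f' x \<partial>std_gauss)"
proof -
  have contf: "continuous_on UNIV f"
    using deriv by (meson DERIV_continuous continuous_at_imp_continuous_on)
  have [measurable]: "f \<in> borel_measurable borel" "f' \<in> borel_measurable borel"
    using contf cont by (auto intro: borel_measurable_continuous_onI)
  have "integrable std_gauss (\<lambda>x. B * x)"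
    using integrable_std_gauss_power[of 1] by simp
  then have i1: "integrable std_gauss (\<lambda>x. x * f x)"
    by (rule Bochner_Integration.integrable_bound)
      (auto intro!: AE_I2 mult_mono order_trans[OF bound(1) abs_ge_self] simp: abs_mult mult.commute[of _ B] mult.commute[of "\<bar>B\<bar>"])
  have i2: "integrable std_gauss f'"
    by (rule std_gauss.integrable_const_bound[where B = B']) (auto simp: bound)
  have i: "integrable std_gauss (\<lambda>x. f' x - x * f x)"
    using i1 i2 by simp
  have i': "integrable lborel (\<lambda>x. std_normal_density x * (f' x - x * f x))"
    using i by (subst (asm) integrable_std_gauss) auto
  have lim: "((\<lambda>x. std_normal_density x * f x) \<longlongrightarrow> 0) F"
    if "(std_normal_density \<longlongrightarrow> 0) F" for F
    by (rule tendsto_0_le[OF that, where K = B])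
      (auto intro!: always_eventually mult_right_mono bound simp: abs_mult mult.commute[of "std_normal_density _"])
  have "(LBINT x=-\<infinity>..\<infinity>. std_normal_density x * (f' x - x * f x)) = 0 - 0"
  proof (rule interval_integral_FTC_integrable[where F = "\<lambda>x. std_normal_density x * f x"])
    fix x :: real
    have "((\<lambda>x. C * exp (- x\<^sup>2 / 2)) has_real_derivative - x * (C * exp (- x\<^sup>2 / 2))) (at x)" for C :: real
      by (auto intro!: derivative_eq_intros)
    then have "(std_normal_density has_real_derivative - x * std_normal_density x) (at x)"
      unfolding std_normal_density_def[abs_def] .
    then have "((\<lambda>x. std_normal_density x * f x) has_real_derivative
        (std_normal_density x * f' x + (- x * std_normal_density x) * f x)) (at x)"
      by (auto intro!: derivative_eq_intros deriv)
    then show "((\<lambda>x. std_normal_density x * f x) has_vector_derivative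
        std_normal_density x * (f' x - x * f x)) (at x)"
      by (simp add: has_real_derivative_iff_has_vector_derivative algebra_simps)
    have "continuous_on UNIV (\<lambda>x. std_normal_density x * (f' x - x * f x))"
      unfolding std_normal_density_def by (intro continuous_intros cont contf) auto
    then show "isCont (\<lambda>x. std_normal_density x * (f' x - x * f x)) x"
      by (simp add: continuous_on_eq_continuous_at)
  next
    show "set_integrable lborel (einterval (- \<infinity>) \<infinity>) (\<lambda>x. std_normal_density x * (f' x - x * f x))"
      using i' by (simp add: set_integrable_def)
    show "(((\<lambda>x. std_normal_density x * f x) \<circ> real_of_ereal) \<longlongrightarrow> 0) (at_right (- \<infinity>))"
      "(((\<lambda>x. std_normal_density x * f x) \<circ> real_of_ereal) \<longlongrightarrow> 0) (at_left \<infinity>)"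
      using lim std_normal_density_tendsto_0
      by (auto simp: ereal_tendsto_simps1)
  qed simp
  then have "(\<integral>x. std_normal_density x * (f' x - x * f x) \<partial>lborel) = 0"
    by (simp add: interval_integral_to_infinity_eq interval_lebesgue_integral_def set_lebesgue_integral_def)
  then have "(\<integral>x. f' x - x * f x \<partial>std_gauss) = 0"
    by (subst integral_std_gauss) auto
  then show ?thesis
    using i1 i2 by simp
qed

lemma measurable_PiM_std_gauss_component:
  "k \<in> K \<Longrightarrow> (\<lambda>x. x k) \<in> borel_measurable (PiM K (\<lambda>_. std_gauss))"
  by (rule measurable_compose[OF measurable_component_singleton])
    (simp_all add: measurable_ident_sets)

lemma finite_measure_PiM_std_gauss: "finite_measure (PiM K (\<lambda>_. std_gauss))"
  by (intro prob_space.finite_measure prob_space_PiM prob_space_std_gauss)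

lemma integrable_PiM_std_gauss_component:
  fixes f :: "real \<Rightarrow> real"
  assumes "k \<in> K" "integrable std_gauss f"
  shows "integrable (PiM K (\<lambda>_. std_gauss)) (\<lambda>x. f (x k))"
proof (rule integrable_distr[where M' = std_gauss and T = "\<lambda>x. x k" and f = f, simplified comp_def])
  show "(\<lambda>x. x k) \<in> measurable (PiM K (\<lambda>_. std_gauss)) std_gauss"
    using assms by measurable
  show "integrable (distr (PiM K (\<lambda>_. std_gauss)) std_gauss (\<lambda>x. x k)) f"
    using assms distr_PiM_component[of K "\<lambda>_. std_gauss" k, OF prob_space_std_gauss] by simp
qed

lemma integral_PiM_std_gauss_component:
  fixes f :: "real \<Rightarrow> real"
  assumes "k \<in> K" "f \<in> borel_measurable borel"
  shows "(\<integral>x. f (x k) \<partial>PiM K (\<lambda>_. std_gauss)) = (\<integral>x. f x \<partial>std_gauss)"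
proof -
  have "(\<integral>x. f (x k) \<partial>PiM K (\<lambda>_. std_gauss)) = (\<integral>x. f x \<partial>distr (PiM K (\<lambda>_. std_gauss)) std_gauss (\<lambda>x. x k))"
    using assms by (intro integral_distr[symmetric]) auto
  then show ?thesis
    using assms distr_PiM_component[of K "\<lambda>_. std_gauss" k, OF prob_space_std_gauss] by simp
qed

text \<open>Fubini singles out coordinate \<open>k\<close>, and the one-dimensional identity applies
  with the other coordinates frozen. Function updates express that \<open>f'\<close> is the partial
  derivative of \<open>f\<close> in that coordinate.\<close>

lemma PiM_std_gauss_integral_by_parts:
  fixes f f' :: "('k \<Rightarrow> real) \<Rightarrow> real"
  assumes K: "finite K" "k \<in> K"
    and [measurable]: "f \<in> borel_measurable (PiM K (\<lambda>_. std_gauss))"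
      "f' \<in> borel_measurable (PiM K (\<lambda>_. std_gauss))"
    and deriv: "\<And>x y. ((\<lambda>y. f (x(k := y))) has_real_derivative f' (x(k := y))) (at y)"
    and cont: "\<And>x. continuous_on UNIV (\<lambda>y. f' (x(k := y)))"
    and bound: "\<And>x. \<bar>f x\<bar> \<le> B" "\<And>x. \<bar>f' x\<bar> \<le> B'"
  shows "(\<integral>x. x k * f x \<partial>PiM K (\<lambda>_. std_gauss)) = (\<integral>x. f' x \<partial>PiM K (\<lambda>_. std_gauss))"
proof -
  let ?P = "PiM K (\<lambda>_. std_gauss)"
  note [measurable] = measurable_PiM_std_gauss_component[OF K(2)]
  have "integrable ?P (\<lambda>x. B * x k)"
    using integrable_PiM_std_gauss_component[OF K(2) integrable_std_gauss_power[of 1]] by simp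
  then have i1: "integrable ?P (\<lambda>x. x k * f x)"
    by (rule Bochner_Integration.integrable_bound)
      (auto intro!: AE_I2 mult_mono order_trans[OF bound(1) abs_ge_self] simp: abs_mult mult.commute[of _ B] mult.commute[of "\<bar>B\<bar>"])
  have i2: "integrable ?P f'"
    by (rule finite_measure.integrable_const_bound[OF finite_measure_PiM_std_gauss, where B = B']) (auto simp: bound)
  have "(\<integral>x. x k * f x \<partial>?P) = (\<integral>x. (\<integral>y. y * f (x(k := y)) \<partial>std_gauss) \<partial>PiM (K - {k}) (\<lambda>_. std_gauss))"
    using std_gauss_prod.product_integral_insert[of "K - {k}" k "\<lambda>x. x k * f x"] K i1 by (simp add: insert_absorb)
  also have "\<dots> = (\<integral>x. (\<integral>y. f' (x(k := y)) \<partial>std_gauss) \<partial>PiM (K - {k}) (\<lambda>_. std_gauss))"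
    by (rule Bochner_Integration.integral_cong[OF refl], rule std_gauss_integral_by_parts)
      (rule deriv cont bound)+
  also have "\<dots> = (\<integral>x. f' x \<partial>?P)"
    using std_gauss_prod.product_integral_insert[of "K - {k}" k f'] K i2 by (simp add: insert_absorb)
  finally show ?thesis .
qed

section \<open>Comparison of Gaussian log-partition functions\<close>

locale gibbs_weights =
  fixes Om :: "'o set" and w :: "'o \<Rightarrow> real"
  assumes finite_Om: "finite Om" and Om_ne: "Om \<noteq> {}" and w_pos: "\<And>\<omega>. \<omega> \<in> Om \<Longrightarrow> w \<omega> > 0"
begin

definition part :: "('o \<Rightarrow> real) \<Rightarrow> real" where
  "part h = (\<Sum>\<omega>\<in>Om. w \<omega> * exp (h \<omega>))"

definition gibbs :: "('o \<Rightarrow> real) \<Rightarrow> 'o \<Rightarrow> real" where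
  "gibbs h \<omega> = w \<omega> * exp (h \<omega>) / part h"

lemma part_pos: "part h > 0"
  unfolding part_def using finite_Om Om_ne w_pos by (intro sum_pos) auto

lemma gibbs_nonneg: "\<omega> \<in> Om \<Longrightarrow> gibbs h \<omega> \<ge> 0"
  unfolding gibbs_def using part_pos[of h] w_pos[of \<omega>] by (simp add: less_imp_le)

lemma sum_gibbs: "(\<Sum>\<omega>\<in>Om. gibbs h \<omega>) = 1"
  unfolding gibbs_def sum_divide_distrib[symmetric] using part_pos[of h] by (simp add: part_def)

lemma gibbs_le_1: "\<omega> \<in> Om \<Longrightarrow> gibbs h \<omega> \<le> 1"
  using sum_gibbs[of h] member_le_sum[of \<omega> Om "gibbs h"] gibbs_nonneg finite_Om by auto

lemma gibbs_average_bound: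
  assumes "\<And>\<omega>. \<omega> \<in> Om \<Longrightarrow> \<bar>u \<omega>\<bar> \<le> M"
  shows "\<bar>\<Sum>\<omega>\<in>Om. gibbs h \<omega> * u \<omega>\<bar> \<le> M"
proof -
  have "\<bar>\<Sum>\<omega>\<in>Om. gibbs h \<omega> * u \<omega>\<bar> \<le> (\<Sum>\<omega>\<in>Om. gibbs h \<omega> * M)"
    by (rule order_trans[OF sum_abs])
      (auto intro!: sum_mono mult_left_mono assms simp: abs_mult gibbs_nonneg)
  then show ?thesis
    by (simp add: sum_distrib_right[symmetric] sum_gibbs)
qed

lemma ln_part_bound:
  assumes "\<And>\<omega>. \<omega> \<in> Om \<Longrightarrow> \<bar>h \<omega>\<bar> \<le> M"
  shows "\<bar>ln (part h)\<bar> \<le> \<bar>ln (\<Sum>\<omega>\<in>Om. w \<omega>)\<bar> + M"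
proof -
  let ?W = "\<Sum>\<omega>\<in>Om. w \<omega>"
  have W: "?W > 0"
    using finite_Om Om_ne w_pos by (intro sum_pos) auto
  have h: "h \<omega> \<le> M" "- M \<le> h \<omega>" if "\<omega> \<in> Om" for \<omega>
    using assms[OF that] by auto
  have "part h \<le> ?W * exp M" "?W * exp (- M) \<le> part h"
    unfolding part_def sum_distrib_right using h w_pos
    by (auto intro!: sum_mono mult_left_mono less_imp_le[OF w_pos])
  then have "ln (part h) \<le> ln (?W * exp M)" "ln (?W * exp (- M)) \<le> ln (part h)"
    using part_pos W by (subst ln_le_cancel_iff; simp)+
  then show ?thesis
    using W by (simp add: ln_mult)
qed

lemma has_derivative_part:
  assumes "\<And>\<omega>. \<omega> \<in> Om \<Longrightarrow> ((\<lambda>t. h t \<omega>) has_real_derivative h' \<omega>) (at t)"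
  shows "((\<lambda>t. part (h t)) has_real_derivative part (h t) * (\<Sum>\<omega>\<in>Om. gibbs (h t) \<omega> * h' \<omega>)) (at t)"
proof -
  have "((\<lambda>t. part (h t)) has_real_derivative (\<Sum>\<omega>\<in>Om. w \<omega> * (exp (h t \<omega>) * h' \<omega>))) (at t)"
    unfolding part_def by (auto intro!: derivative_eq_intros assms sum.cong)
  also have "(\<Sum>\<omega>\<in>Om. w \<omega> * (exp (h t \<omega>) * h' \<omega>)) = part (h t) * (\<Sum>\<omega>\<in>Om. gibbs (h t) \<omega> * h' \<omega>)"
    unfolding sum_distrib_left gibbs_def using part_pos[of "h t"] by (intro sum.cong) auto
  finally show ?thesis .
qed

lemma has_derivative_ln_part:
  assumes "\<And>\<omega>. \<omega> \<in> Om \<Longrightarrow> ((\<lambda>t. h t \<omega>) has_real_derivative h' \<omega>) (at t)"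
  shows "((\<lambda>t. ln (part (h t))) has_real_derivative (\<Sum>\<omega>\<in>Om. gibbs (h t) \<omega> * h' \<omega>)) (at t)"
  using part_pos[of "h t"] by (auto intro!: derivative_eq_intros has_derivative_part assms)

text \<open>The logarithmic derivative of the numerator minus that of the normalisation. The
  subtracted average is what introduces a second replica \<open>\<omega>'\<close> once this is
  combined with integration by parts.\<close>

lemma has_derivative_gibbs:
  assumes "\<And>\<omega>. \<omega> \<in> Om \<Longrightarrow> ((\<lambda>t. h t \<omega>) has_real_derivative h' \<omega>) (at t)" and "\<omega> \<in> Om"
  shows "((\<lambda>t. gibbs (h t) \<omega>) has_real_derivative
    gibbs (h t) \<omega> * (h' \<omega> - (\<Sum>\<omega>'\<in>Om. gibbs (h t) \<omega>' * h' \<omega>'))) (at t)"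
  unfolding gibbs_def[of _ \<omega>] using part_pos[of "h t"]
  by (auto intro!: derivative_eq_intros has_derivative_part assms simp: field_simps)

lemma measurable_part[measurable]:
  "(\<And>\<omega>. \<omega> \<in> Om \<Longrightarrow> (\<lambda>x. h x \<omega>) \<in> borel_measurable M) \<Longrightarrow> (\<lambda>x. part (h x)) \<in> borel_measurable M"
  unfolding part_def by measurable

lemma measurable_gibbs[measurable]:
  "(\<And>\<omega>. \<omega> \<in> Om \<Longrightarrow> (\<lambda>x. h x \<omega>) \<in> borel_measurable M) \<Longrightarrow> \<omega> \<in> Om \<Longrightarrow>
    (\<lambda>x. gibbs (h x) \<omega>) \<in> borel_measurable M"
  unfolding gibbs_def by (intro borel_measurable_divide borel_measurable_times measurable_part) auto

lemma continuous_gibbs: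
  assumes "\<And>\<omega>. \<omega> \<in> Om \<Longrightarrow> continuous_on S (\<lambda>x. h x \<omega>)" and "\<omega> \<in> Om"
  shows "continuous_on S (\<lambda>x. gibbs (h x) \<omega>)"
  using part_pos unfolding gibbs_def
  by (auto intro!: continuous_intros assms simp: part_def less_imp_neq[THEN not_sym])

end

section \<open>Interpolation between two independent Gaussian families\<close>

text \<open>Both families are linear forms in the same standard Gaussians \<open>x k\<close>, with
  coefficients \<open>a\<close> and \<open>b\<close>. For jointly Gaussian variables
  \<open>uncorrelated\<close> means independence, and \<open>m\<close> bounds how far the covariance
  of the \<open>b\<close> family may exceed that of the \<open>a\<close> family.\<close>

locale gaussian_interpolation = gibbs_weights Om w for Om :: "'o set" and w +
  fixes K :: "'k set" and a b :: "'k \<Rightarrow> 'o \<Rightarrow> real" and m :: real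
  assumes finite_K: "finite K"
    and uncorrelated: "\<And>\<omega> \<omega>'. \<omega> \<in> Om \<Longrightarrow> \<omega>' \<in> Om \<Longrightarrow> (\<Sum>k\<in>K. a k \<omega> * b k \<omega>') = 0"
    and cov_diff: "\<And>\<omega> \<omega>'. \<omega> \<in> Om \<Longrightarrow> \<omega>' \<in> Om \<Longrightarrow>
      (\<Sum>k\<in>K. a k \<omega> * a k \<omega>') - (\<Sum>k\<in>K. b k \<omega> * b k \<omega>') \<ge> - m"
begin

definition c :: "real \<Rightarrow> 'k \<Rightarrow> 'o \<Rightarrow> real" where
  "c t k \<omega> = sin t * a k \<omega> + cos t * b k \<omega>"

definition c' :: "real \<Rightarrow> 'k \<Rightarrow> 'o \<Rightarrow> real" where
  "c' t k \<omega> = cos t * a k \<omega> - sin t * b k \<omega>"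

text \<open>Subtracting half the variance gives \<open>exp (h t x \<omega>)\<close> mean one under
  \<open>P\<close> for every \<open>t\<close>.\<close>

definition h :: "real \<Rightarrow> ('k \<Rightarrow> real) \<Rightarrow> 'o \<Rightarrow> real" where
  "h t x \<omega> = (\<Sum>k\<in>K. c t k \<omega> * x k) - 1/2 * (\<Sum>k\<in>K. (c t k \<omega>)\<^sup>2)"

definition h' :: "real \<Rightarrow> ('k \<Rightarrow> real) \<Rightarrow> 'o \<Rightarrow> real" where
  "h' t x \<omega> = (\<Sum>k\<in>K. c' t k \<omega> * x k) - (\<Sum>k\<in>K. c' t k \<omega> * c t k \<omega>)"

abbreviation P :: "('k \<Rightarrow> real) measure" where
  "P \<equiv> PiM K (\<lambda>_. std_gauss)"

definition B :: real where
  "B = (\<Sum>k\<in>K. \<Sum>\<omega>\<in>Om. \<bar>a k \<omega>\<bar> + \<bar>b k \<omega>\<bar>)"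

lemma ab_bound: "k \<in> K \<Longrightarrow> \<omega> \<in> Om \<Longrightarrow> \<bar>a k \<omega>\<bar> + \<bar>b k \<omega>\<bar> \<le> B"
proof -
  assume k: "k \<in> K" and \<omega>: "\<omega> \<in> Om"
  have "\<bar>a k \<omega>\<bar> + \<bar>b k \<omega>\<bar> \<le> (\<Sum>\<omega>\<in>Om. \<bar>a k \<omega>\<bar> + \<bar>b k \<omega>\<bar>)"
    using finite_Om \<omega> by (intro member_le_sum) auto
  also have "\<dots> \<le> B"
    unfolding B_def using finite_K k by (intro member_le_sum[of k K "\<lambda>k. \<Sum>\<omega>\<in>Om. \<bar>a k \<omega>\<bar> + \<bar>b k \<omega>\<bar>"]) (auto intro!: sum_nonneg)
  finally show ?thesis .
qed

lemma B_nonneg: "B \<ge> 0"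
  unfolding B_def by (intro sum_nonneg) auto

lemma
  assumes "k \<in> K" "\<omega> \<in> Om"
  shows c_bound: "\<bar>c t k \<omega>\<bar> \<le> B" and c'_bound: "\<bar>c' t k \<omega>\<bar> \<le> B"
proof -
  have *: "\<bar>sin t * u\<bar> \<le> \<bar>u\<bar>" "\<bar>cos t * u\<bar> \<le> \<bar>u\<bar>" for u
    using mult_right_mono[OF abs_sin_le_one[of t], of "\<bar>u\<bar>"] mult_right_mono[OF abs_cos_le_one[of t], of "\<bar>u\<bar>"]
    by (auto simp: abs_mult)
  show "\<bar>c t k \<omega>\<bar> \<le> B" "\<bar>c' t k \<omega>\<bar> \<le> B"
    unfolding c_def c'_def
    using ab_bound[OF assms] *[of "a k \<omega>"] *[of "b k \<omega>"] by linarith+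
qed

text \<open>A dominating function for \<open>h\<close> and \<open>h'\<close> at once: it is
  independent of \<open>t\<close> and \<open>\<omega>\<close> and grows linearly in the Gaussians,
  hence is integrable.\<close>

definition G :: "('k \<Rightarrow> real) \<Rightarrow> real" where
  "G x = B * (\<Sum>k\<in>K. \<bar>x k\<bar>) + real (card K) * B\<^sup>2"

lemma
  assumes "\<omega> \<in> Om"
  shows h_bound: "\<bar>h t x \<omega>\<bar> \<le> G x" and h'_bound: "\<bar>h' t x \<omega>\<bar> \<le> G x"
proof -
  have 1: "\<bar>\<Sum>k\<in>K. u k * x k\<bar> \<le> B * (\<Sum>k\<in>K. \<bar>x k\<bar>)" if "\<And>k. k \<in> K \<Longrightarrow> \<bar>u k\<bar> \<le> B" for u
    unfolding sum_distrib_left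
    by (rule order_trans[OF sum_abs]) (auto simp: abs_mult intro!: sum_mono mult_right_mono that)
  have 2: "\<bar>\<Sum>k\<in>K. u k * v k\<bar> \<le> real (card K) * B\<^sup>2"
    if "\<And>k. k \<in> K \<Longrightarrow> \<bar>u k\<bar> \<le> B" "\<And>k. k \<in> K \<Longrightarrow> \<bar>v k\<bar> \<le> B" for u v
  proof (rule order_trans[OF sum_abs sum_bounded_above])
    show "\<bar>u k * v k\<bar> \<le> B\<^sup>2" if "k \<in> K" for k
      using \<open>k \<in> K\<close> that B_nonneg unfolding abs_mult power2_eq_square
      by (intro mult_mono) (auto simp: \<open>\<And>k. k \<in> K \<Longrightarrow> \<bar>u k\<bar> \<le> B\<close> \<open>\<And>k. k \<in> K \<Longrightarrow> \<bar>v k\<bar> \<le> B\<close>)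
  qed
  have "\<bar>h t x \<omega>\<bar> \<le> \<bar>\<Sum>k\<in>K. c t k \<omega> * x k\<bar> + \<bar>\<Sum>k\<in>K. c t k \<omega> * c t k \<omega>\<bar>"
    unfolding h_def power2_eq_square by linarith
  then show "\<bar>h t x \<omega>\<bar> \<le> G x"
    unfolding G_def using 1[of "\<lambda>k. c t k \<omega>"] 2[of "\<lambda>k. c t k \<omega>" "\<lambda>k. c t k \<omega>"] c_bound[OF _ assms] by force
  have "\<bar>h' t x \<omega>\<bar> \<le> \<bar>\<Sum>k\<in>K. c' t k \<omega> * x k\<bar> + \<bar>\<Sum>k\<in>K. c' t k \<omega> * c t k \<omega>\<bar>"
    unfolding h'_def by linarith
  then show "\<bar>h' t x \<omega>\<bar> \<le> G x"
    unfolding G_def using 1[of "\<lambda>k. c' t k \<omega>"] 2[of "\<lambda>k. c' t k \<omega>" "\<lambda>k. c t k \<omega>"]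
      c_bound[OF _ assms] c'_bound[OF _ assms] by force
qed

lemma measurable_P_component[measurable]: "k \<in> K \<Longrightarrow> (\<lambda>x. x k) \<in> borel_measurable P"
  by (rule measurable_PiM_std_gauss_component)

lemma measurable_h[measurable]: "(\<lambda>x. h t x \<omega>) \<in> borel_measurable P"
  unfolding h_def by measurable

lemma measurable_h'[measurable]: "(\<lambda>x. h' t x \<omega>) \<in> borel_measurable P"
  unfolding h'_def by measurable

lemma integrable_G: "integrable P G"
proof -
  have "integrable std_gauss (\<lambda>x. \<bar>x\<bar>)"
    using integrable_abs[OF integrable_std_gauss_power[of 1]] by simp
  then have "integrable P (\<lambda>x. \<bar>x k\<bar>)" if "k \<in> K" for k
    using that by (rule integrable_PiM_std_gauss_component[rotated])
  then show ?thesis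
    unfolding G_def[abs_def]
    using finite_measure.integrable_const[OF finite_measure_PiM_std_gauss[of K]] by auto
qed

lemma h_deriv: "((\<lambda>t. h t x \<omega>) has_real_derivative h' t x \<omega>) (at t)"
proof -
  have [derivative_intros]: "((\<lambda>t. c t k \<omega>) has_real_derivative c' t k \<omega>) (at t)" for k
    unfolding c_def c'_def by (auto intro!: derivative_eq_intros)
  show ?thesis
    unfolding h_def h'_def
    by (auto intro!: derivative_eq_intros simp: sum_distrib_left mult_ac)
qed

lemma h_upd:
  assumes "k \<in> K"
  shows "h t (x(k := y)) \<omega> = h t x \<omega> + c t k \<omega> * (y - x k)"
proof -
  have "(\<Sum>j\<in>K. c t j \<omega> * (x(k := y)) j) = (\<Sum>j\<in>K. c t j \<omega> * x j) + c t k \<omega> * (y - x k)"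
    using finite_K assms by (simp add: sum.remove[of K k] algebra_simps)
  then show ?thesis
    by (simp add: h_def)
qed

text \<open>In each Gaussian coordinate \<open>h\<close> is affine with slope
  \<open>c t k \<omega>\<close>, so the Gibbs derivative formula supplies the partial derivative. It
  is at most \<open>2 * B\<close> in modulus, since a slope and an average of slopes each contribute
  at most \<open>B\<close>.\<close>

lemma gibbs_by_parts:
  assumes k: "k \<in> K" and \<omega>: "\<omega> \<in> Om"
  shows "(\<integral>x. x k * gibbs (h t x) \<omega> \<partial>P) =
    (\<integral>x. gibbs (h t x) \<omega> * (c t k \<omega> - (\<Sum>\<omega>'\<in>Om. gibbs (h t x) \<omega>' * c t k \<omega>')) \<partial>P)"
proof (rule PiM_std_gauss_integral_by_parts[OF finite_K k, where B = 1 and B' = "2 * B"])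
  let ?f = "\<lambda>x. gibbs (h t x) \<omega>"
  let ?f' = "\<lambda>x. gibbs (h t x) \<omega> * (c t k \<omega> - (\<Sum>\<omega>'\<in>Om. gibbs (h t x) \<omega>' * c t k \<omega>'))"
  show "?f \<in> borel_measurable P" "?f' \<in> borel_measurable P"
    using \<omega> by measurable
  show "((\<lambda>y. ?f (x(k := y))) has_real_derivative ?f' (x(k := y))) (at y)" for x y
    using \<omega> by (intro has_derivative_gibbs)
      (auto simp: h_upd[OF k] intro!: derivative_eq_intros)
  show "continuous_on UNIV (\<lambda>y. ?f' (x(k := y)))" for x
    using \<omega> by (intro continuous_intros continuous_gibbs) (auto simp: h_upd[OF k] intro!: continuous_intros)
  show "\<bar>?f x\<bar> \<le> 1" for x
    using gibbs_nonneg[OF \<omega>] gibbs_le_1[OF \<omega>] by (simp add: abs_le_iff order_trans[of _ 0])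
  have "\<bar>c t k \<omega> - (\<Sum>\<omega>'\<in>Om. gibbs (h t x) \<omega>' * c t k \<omega>')\<bar> \<le> 2 * B" for x
    using c_bound[OF k \<omega>, of t] gibbs_average_bound[of "\<lambda>\<omega>. c t k \<omega>" B "h t x", OF c_bound[OF k]]
    by linarith
  then show "\<bar>?f' x\<bar> \<le> 2 * B" for x
    using gibbs_nonneg[OF \<omega>] gibbs_le_1[OF \<omega>] mult_mono[of "\<bar>?f x\<bar>" 1 _ "2 * B"]
    by (simp add: abs_mult)
qed

text \<open>The crossed terms vanish by \<open>uncorrelated\<close>, leaving
  \<open>sin t * cos t\<close> times the covariance difference. On the quarter circle this prefactor
  is non-negative, so the one-sided bound \<open>cov_diff\<close> can be multiplied by it.\<close>

lemma overlap_bound: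
  assumes "0 \<le> t" "t \<le> pi / 2" and \<omega>: "\<omega> \<in> Om" "\<omega>' \<in> Om"
  shows "(\<Sum>k\<in>K. c' t k \<omega> * c t k \<omega>') \<ge> - (m * (sin t * cos t))"
proof -
  have "(\<Sum>k\<in>K. c' t k \<omega> * c t k \<omega>') = (\<Sum>k\<in>K. sin t * cos t * (a k \<omega> * a k \<omega>') - sin t * cos t * (b k \<omega> * b k \<omega>')
      + (cos t)\<^sup>2 * (a k \<omega> * b k \<omega>') - (sin t)\<^sup>2 * (a k \<omega>' * b k \<omega>))"
    unfolding c_def c'_def by (intro sum.cong) (auto simp: algebra_simps power2_eq_square)
  also have "\<dots> = sin t * cos t * ((\<Sum>k\<in>K. a k \<omega> * a k \<omega>') - (\<Sum>k\<in>K. b k \<omega> * b k \<omega>'))"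
    using uncorrelated \<omega>
    by (simp add: sum.distrib sum_subtractf sum_distrib_left[symmetric] right_diff_distrib)
  also have "\<dots> \<ge> sin t * cos t * (- m)"
    using assms cov_diff by (intro mult_left_mono mult_nonneg_nonneg sin_ge_zero cos_ge_zero) auto
  finally show ?thesis by (simp add: mult.commute)
qed

lemma ln_part_deriv:
  "((\<lambda>t. \<integral>x. ln (part (h t x)) \<partial>P) has_real_derivative
    (\<integral>x. (\<Sum>\<omega>\<in>Om. gibbs (h t x) \<omega> * h' t x \<omega>) \<partial>P)) (at t)"
proof (rule has_real_derivative_integral[OF _ _ _ integrable_G])
  show "((\<lambda>t. ln (part (h t x))) has_real_derivative (\<Sum>\<omega>\<in>Om. gibbs (h t x) \<omega> * h' t x \<omega>)) (at t)" for t x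
    by (intro has_derivative_ln_part h_deriv)
  show "integrable P (\<lambda>x. ln (part (h t x)))" for t
  proof (rule Bochner_Integration.integrable_bound)
    show "integrable P (\<lambda>x. \<bar>ln (\<Sum>\<omega>\<in>Om. w \<omega>)\<bar> + G x)"
      using finite_measure.integrable_const[OF finite_measure_PiM_std_gauss[of K]] integrable_G by auto
    show "AE x in P. norm (ln (part (h t x))) \<le> norm (\<bar>ln (\<Sum>\<omega>\<in>Om. w \<omega>)\<bar> + G x)"
      by (intro AE_I2) (auto intro: order_trans[OF ln_part_bound[OF h_bound] abs_ge_self])
  qed measurable
  show "\<bar>\<Sum>\<omega>\<in>Om. gibbs (h t x) \<omega> * h' t x \<omega>\<bar> \<le> G x" for t x
    by (intro gibbs_average_bound h'_bound)
qed measurable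

text \<open>Integration by parts turns each \<open>x k\<close> into a one-replica term
  \<open>?R \<omega> \<omega>\<close> minus a two-replica average. The former cancels against the
  counterterm in \<open>h'\<close>; the latter is an average of overlaps with non-negative weights
  of total mass one, so the pointwise bound on overlaps carries over.\<close>

lemma ln_part_deriv_le:
  assumes t: "0 \<le> t" "t \<le> pi / 2"
  shows "(\<integral>x. (\<Sum>\<omega>\<in>Om. gibbs (h t x) \<omega> * h' t x \<omega>) \<partial>P) \<le> m * (sin t * cos t)"
proof -
  let ?g = "\<lambda>x \<omega>. gibbs (h t x) \<omega>"
  let ?R = "\<lambda>\<omega> \<omega>'. \<Sum>k\<in>K. c' t k \<omega> * c t k \<omega>'"
  have gabs: "\<bar>?g x \<omega>\<bar> \<le> 1" if "\<omega> \<in> Om" for x \<omega>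
    using gibbs_nonneg[OF that] gibbs_le_1[OF that] by (simp add: abs_le_iff order_trans[of _ 0])
  have ig: "integrable P (\<lambda>x. ?g x \<omega>)" if "\<omega> \<in> Om" for \<omega>
    using that by (intro finite_measure.integrable_const_bound[OF finite_measure_PiM_std_gauss, where B = 1]) (auto simp: gabs)
  have igg: "integrable P (\<lambda>x. ?g x \<omega> * ?g x \<omega>')" if "\<omega> \<in> Om" "\<omega>' \<in> Om" for \<omega> \<omega>'
    using that mult_mono[OF gabs gabs]
    by (intro finite_measure.integrable_const_bound[OF finite_measure_PiM_std_gauss, where B = 1]) (auto simp: abs_mult)
  have ixg: "integrable P (\<lambda>x. x k * ?g x \<omega>)" if "k \<in> K" "\<omega> \<in> Om" for k \<omega>
  proof (rule Bochner_Integration.integrable_bound)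
    show "integrable P (\<lambda>x. x k)"
      using integrable_PiM_std_gauss_component[OF that(1) integrable_std_gauss_power[of 1]] by simp
    show "AE x in P. norm (x k * ?g x \<omega>) \<le> norm (x k)"
      using mult_left_mono[OF gabs[OF that(2)]] by (auto simp: abs_mult intro!: AE_I2)
  qed (use that in measurable)
  have "(\<integral>x. (\<Sum>\<omega>\<in>Om. ?g x \<omega> * h' t x \<omega>) \<partial>P) =
      (\<integral>x. (\<Sum>\<omega>\<in>Om. (\<Sum>k\<in>K. c' t k \<omega> * (x k * ?g x \<omega>)) - ?R \<omega> \<omega> * ?g x \<omega>) \<partial>P)"
    by (intro Bochner_Integration.integral_cong refl sum.cong)
      (auto simp: h'_def algebra_simps sum_distrib_left)
  also have "\<dots> = (\<Sum>\<omega>\<in>Om. (\<Sum>k\<in>K. c' t k \<omega> * (\<integral>x. x k * ?g x \<omega> \<partial>P)) - ?R \<omega> \<omega> * (\<integral>x. ?g x \<omega> \<partial>P))"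
    by (simp add: ig ixg)
  also have "\<dots> = (\<Sum>\<omega>\<in>Om. (\<Sum>k\<in>K. c' t k \<omega> * (c t k \<omega> * (\<integral>x. ?g x \<omega> \<partial>P)
      - (\<Sum>\<omega>'\<in>Om. c t k \<omega>' * (\<integral>x. ?g x \<omega> * ?g x \<omega>' \<partial>P)))) - ?R \<omega> \<omega> * (\<integral>x. ?g x \<omega> \<partial>P))"
  proof (intro sum.cong refl arg_cong2[where f = "(-)"] arg_cong2[where f = "(*)"])
    fix \<omega> k assume \<omega>: "\<omega> \<in> Om" and k: "k \<in> K"
    have "(\<integral>x. x k * ?g x \<omega> \<partial>P) =
        (\<integral>x. c t k \<omega> * ?g x \<omega> - (\<Sum>\<omega>'\<in>Om. c t k \<omega>' * (?g x \<omega> * ?g x \<omega>')) \<partial>P)"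
      unfolding gibbs_by_parts[OF k \<omega>]
      by (intro Bochner_Integration.integral_cong refl) (auto simp: algebra_simps sum_distrib_left)
    also have "\<dots> = c t k \<omega> * (\<integral>x. ?g x \<omega> \<partial>P) - (\<Sum>\<omega>'\<in>Om. c t k \<omega>' * (\<integral>x. ?g x \<omega> * ?g x \<omega>' \<partial>P))"
      using \<omega> by (simp add: ig igg)
    finally show "(\<integral>x. x k * ?g x \<omega> \<partial>P) = c t k \<omega> * (\<integral>x. ?g x \<omega> \<partial>P) - (\<Sum>\<omega>'\<in>Om. c t k \<omega>' * (\<integral>x. ?g x \<omega> * ?g x \<omega>' \<partial>P))" .
  qed
  \<comment> \<open>The self-overlaps cancel here: this is the purpose of the half variance in
    \<open>h\<close>.\<close>
  also have "\<dots> = (\<Sum>\<omega>\<in>Om. - (\<Sum>\<omega>'\<in>Om. ?R \<omega> \<omega>' * (\<integral>x. ?g x \<omega> * ?g x \<omega>' \<partial>P)))"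
  proof (intro sum.cong refl)
    fix \<omega> assume "\<omega> \<in> Om"
    have "(\<Sum>k\<in>K. c' t k \<omega> * (\<Sum>\<omega>'\<in>Om. c t k \<omega>' * (\<integral>x. ?g x \<omega> * ?g x \<omega>' \<partial>P)))
      = (\<Sum>\<omega>'\<in>Om. ?R \<omega> \<omega>' * (\<integral>x. ?g x \<omega> * ?g x \<omega>' \<partial>P))"
      unfolding sum_distrib_left sum_distrib_right by (subst sum.swap) (simp add: mult_ac)
    then show "(\<Sum>k\<in>K. c' t k \<omega> * (c t k \<omega> * (\<integral>x. ?g x \<omega> \<partial>P)
      - (\<Sum>\<omega>'\<in>Om. c t k \<omega>' * (\<integral>x. ?g x \<omega> * ?g x \<omega>' \<partial>P)))) - ?R \<omega> \<omega> * (\<integral>x. ?g x \<omega> \<partial>P)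
      = - (\<Sum>\<omega>'\<in>Om. ?R \<omega> \<omega>' * (\<integral>x. ?g x \<omega> * ?g x \<omega>' \<partial>P))"
      by (simp add: right_diff_distrib sum_subtractf sum_distrib_right mult.assoc)
  qed
  also have "\<dots> \<le> (\<Sum>\<omega>\<in>Om. \<Sum>\<omega>'\<in>Om. m * (sin t * cos t) * (\<integral>x. ?g x \<omega> * ?g x \<omega>' \<partial>P))"
    unfolding sum_negf[symmetric]
  proof (intro sum_mono)
    fix \<omega> \<omega>' assume \<omega>: "\<omega> \<in> Om" "\<omega>' \<in> Om"
    have "(\<integral>x. ?g x \<omega> * ?g x \<omega>' \<partial>P) \<ge> 0"
      using \<omega> by (intro integral_nonneg_AE AE_I2 mult_nonneg_nonneg gibbs_nonneg)
    from mult_right_mono[OF overlap_bound[OF t \<omega>] this]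
    show "- (?R \<omega> \<omega>' * (\<integral>x. ?g x \<omega> * ?g x \<omega>' \<partial>P)) \<le> m * (sin t * cos t) * (\<integral>x. ?g x \<omega> * ?g x \<omega>' \<partial>P)"
      by simp
  qed
  also have "\<dots> = m * (sin t * cos t) * (\<integral>x. (\<Sum>\<omega>\<in>Om. \<Sum>\<omega>'\<in>Om. ?g x \<omega> * ?g x \<omega>') \<partial>P)"
    by (simp add: igg sum_distrib_left)
  also have "(\<integral>x. (\<Sum>\<omega>\<in>Om. \<Sum>\<omega>'\<in>Om. ?g x \<omega> * ?g x \<omega>') \<partial>P) = (\<integral>x. 1 \<partial>P)"
    by (simp only: sum_distrib_left[symmetric] sum_distrib_right[symmetric] sum_gibbs mult_1)
  also have "\<dots> = 1"
    by (simp add: prob_space.prob_space[OF prob_space_PiM[OF prob_space_std_gauss]])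
  finally show ?thesis by simp
qed

text \<open>Kahane's convexity inequality: moving from \<open>b\<close> to \<open>a\<close> along a quarter circle keeps the
  variance terms balanced, and only the covariance difference survives integration by parts.\<close>

lemma gaussian_comparison:
  "(\<integral>x. ln (\<Sum>\<omega>\<in>Om. w \<omega> * exp ((\<Sum>k\<in>K. a k \<omega> * x k) - 1/2 * (\<Sum>k\<in>K. (a k \<omega>)\<^sup>2))) \<partial>P)
   \<le> (\<integral>x. ln (\<Sum>\<omega>\<in>Om. w \<omega> * exp ((\<Sum>k\<in>K. b k \<omega> * x k) - 1/2 * (\<Sum>k\<in>K. (b k \<omega>)\<^sup>2))) \<partial>P) + m / 2"
proof -
  let ?\<phi> = "\<lambda>t. \<integral>x. ln (part (h t x)) \<partial>P"
  \<comment> \<open>The subtracted term is the primitive, vanishing at \<open>0\<close>, of the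
    derivative bound \<open>m * (sin t * cos t)\<close>; its value at \<open>pi / 2\<close> is the
    error \<open>m / 2\<close>.\<close>
  let ?\<psi> = "\<lambda>t. ?\<phi> t - m / 2 * (sin t)\<^sup>2"
  have "?\<psi> (pi / 2) \<le> ?\<psi> 0"
  proof (rule DERIV_nonpos_imp_nonincreasing[where f = ?\<psi>])
    fix t :: real assume t: "0 \<le> t" "t \<le> pi / 2"
    have "(?\<psi> has_real_derivative
      (\<integral>x. (\<Sum>\<omega>\<in>Om. gibbs (h t x) \<omega> * h' t x \<omega>) \<partial>P) - m * (sin t * cos t)) (at t)"
      by (auto intro!: derivative_eq_intros ln_part_deriv)
    then show "\<exists>y. (?\<psi> has_real_derivative y) (at t) \<and> y \<le> 0"
      using ln_part_deriv_le[OF t] by auto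
  qed simp
  then show ?thesis
    by (simp add: part_def h_def c_def)
qed

end

section \<open>Passage to the limit in the partition function\<close>

text \<open>Completing the square: the standard density times this exponential is a multiple of the
  normal density with mean \<open>y / u\<close> and variance \<open>1 / u\<close>. The coefficient
  is written \<open>(u - 1) / 2\<close> so that together with the \<open>1/2\<close> of the density
  it becomes \<open>u / 2\<close>.\<close>

lemma
  fixes u y :: real
  assumes u: "u > 0"
  shows integrable_exp_std_gauss: "integrable std_gauss (\<lambda>z. exp (y * z - (u - 1) / 2 * z\<^sup>2))"
    and integral_exp_std_gauss:
      "(\<integral>z. exp (y * z - (u - 1) / 2 * z\<^sup>2) \<partial>std_gauss) = 1 / sqrt u * exp (y\<^sup>2 / (2 * u))"
proof -
  have s: "1 / sqrt u > 0" using u by simp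
  have eq: "std_normal_density z * exp (y * z - (u - 1) / 2 * z\<^sup>2) =
      1 / sqrt u * exp (y\<^sup>2 / (2 * u)) * normal_density (y / u) (1 / sqrt u) z" for z
  proof -
    have "- z\<^sup>2 / 2 + (y * z - (u - 1) / 2 * z\<^sup>2) = y\<^sup>2 / (2 * u) + - (z - y / u)\<^sup>2 / (2 * (1 / sqrt u)\<^sup>2)"
      using u by (simp add: power_divide power2_diff) (simp add: field_simps power2_eq_square)
    then show ?thesis
      using u unfolding normal_density_def
      by (simp add: exp_add[symmetric] real_sqrt_mult real_sqrt_divide power_divide)
  qed
  show "integrable std_gauss (\<lambda>z. exp (y * z - (u - 1) / 2 * z\<^sup>2))"
    by (subst integrable_std_gauss; (unfold eq)?) (use s in simp_all)
  show "(\<integral>z. exp (y * z - (u - 1) / 2 * z\<^sup>2) \<partial>std_gauss) = 1 / sqrt u * exp (y\<^sup>2 / (2 * u))"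
    by (subst integral_std_gauss; (unfold eq)?) (use s in simp_all)
qed

text \<open>Dominated convergence is applied twice. The inner integral needs only the upper bound,
  whose product form makes its logarithm \<open>C x\<close> plus a constant. For the outer one the
  logarithm must also be bounded below, and discarding everything outside \<open>S\<close> gives
  \<open>- L x\<close> plus the logarithm of the mass of \<open>S\<close>.\<close>

lemma ln_partition_limit:
  fixes \<Phi> :: "nat \<Rightarrow> 'a \<Rightarrow> 'b \<Rightarrow> real"
  assumes \<mu>: "prob_space \<mu>"
    and meas[measurable]: "\<And>n. case_prod (\<Phi> n) \<in> borel_measurable (P \<Otimes>\<^sub>M \<mu>)"
      "case_prod \<Psi> \<in> borel_measurable (P \<Otimes>\<^sub>M \<mu>)"
    and lim: "\<And>x z. x \<in> space P \<Longrightarrow> z \<in> space \<mu> \<Longrightarrow> (\<lambda>n. \<Phi> n x z) \<longlonglongrightarrow> \<Psi> x z"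
    and up: "\<And>n x z. x \<in> space P \<Longrightarrow> z \<in> space \<mu> \<Longrightarrow> exp (\<Phi> n x z) \<le> exp (C x) * H z"
    and H: "integrable \<mu> H"
    and S[measurable]: "S \<in> sets \<mu>" and S_pos: "measure \<mu> S > 0"
    and low: "\<And>n x z. x \<in> space P \<Longrightarrow> z \<in> S \<Longrightarrow> - L x \<le> \<Phi> n x z"
    and C: "integrable P C" and L: "integrable P L" and P: "prob_space P"
  shows "(\<lambda>n. \<integral>x. ln (\<integral>z. exp (\<Phi> n x z) \<partial>\<mu>) \<partial>P) \<longlonglongrightarrow> (\<integral>x. ln (\<integral>z. exp (\<Psi> x z) \<partial>\<mu>) \<partial>P)"
proof -
  interpret \<mu>: prob_space \<mu> by (rule \<mu>)
  let ?Z = "\<lambda>n x. \<integral>z. exp (\<Phi> n x z) \<partial>\<mu>"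
  have [measurable]: "\<Phi> n x \<in> borel_measurable \<mu>" "\<Psi> x \<in> borel_measurable \<mu>" if "x \<in> space P" for n x
    using measurable_compose[OF measurable_Pair1'[OF that] meas(1)]
      measurable_compose[OF measurable_Pair1'[OF that] meas(2)] by auto
  have int: "integrable \<mu> (\<lambda>z. exp (\<Phi> n x z))" if x: "x \<in> space P" for n x
  proof (rule Bochner_Integration.integrable_bound)
    show "integrable \<mu> (\<lambda>z. exp (C x) * H z)" using H by simp
    show "AE z in \<mu>. norm (exp (\<Phi> n x z)) \<le> norm (exp (C x) * H z)"
      using up[OF x] by (auto intro!: AE_I2 intro: order_trans[OF _ abs_ge_self])
  qed (use x in measurable)
  have Z_lim: "(\<lambda>n. ?Z n x) \<longlonglongrightarrow> (\<integral>z. exp (\<Psi> x z) \<partial>\<mu>)" if x: "x \<in> space P" for x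
  proof (rule integral_dominated_convergence[where w = "\<lambda>z. exp (C x) * H z"])
    show "AE z in \<mu>. (\<lambda>n. exp (\<Phi> n x z)) \<longlonglongrightarrow> exp (\<Psi> x z)"
      using lim[OF x] by (intro AE_I2 tendsto_exp)
  qed (use x H up in \<open>auto intro!: AE_I2\<close>)
  have Z_le: "?Z n x \<le> exp (C x) * (\<integral>z. H z \<partial>\<mu>)" if x: "x \<in> space P" for n x
  proof -
    have "?Z n x \<le> (\<integral>z. exp (C x) * H z \<partial>\<mu>)"
      using int[OF x] up[OF x] H by (intro integral_mono) auto
    then show ?thesis by simp
  qed
  have Z_ge: "exp (- L x) * measure \<mu> S \<le> ?Z n x" if x: "x \<in> space P" for n x
  proof -
    have "(\<integral>z. exp (- L x) * indicator S z \<partial>\<mu>) \<le> ?Z n x"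
      using int[OF x] low[OF x]
      by (intro integral_mono integrable_mult_right integrable_real_indicator)
        (auto simp: indicator_def \<mu>.emeasure_eq_measure)
    then show ?thesis using S by simp
  qed
  have Z_pos: "?Z n x > 0" if "x \<in> space P" for n x
    using Z_ge[OF that] S_pos by (meson exp_gt_zero mult_pos_pos order_less_le_trans)
  obtain x0 where x0: "x0 \<in> space P" using prob_space.not_empty[OF P] by auto
  \<comment> \<open>A positive partition function at any one sample point, bounded by a positive
    multiple of this integral, forces its positivity.\<close>
  have H_pos: "(\<integral>z. H z \<partial>\<mu>) > 0"
    using Z_pos[OF x0, of 0] Z_le[OF x0, of 0]
    by (metis exp_gt_zero less_le_trans zero_less_mult_pos)
  let ?W = "\<lambda>x. \<bar>C x\<bar> + \<bar>L x\<bar> + (\<bar>ln (\<integral>z. H z \<partial>\<mu>)\<bar> + \<bar>ln (measure \<mu> S)\<bar>)"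
  show ?thesis
  proof (rule integral_dominated_convergence[where w = ?W])
    show "integrable P ?W"
      by (intro Bochner_Integration.integrable_add integrable_abs C L
        finite_measure.integrable_const[OF prob_space.finite_measure[OF P]])
    show "AE x in P. (\<lambda>n. ln (?Z n x)) \<longlonglongrightarrow> ln (\<integral>z. exp (\<Psi> x z) \<partial>\<mu>)"
    proof (intro AE_I2 tendsto_ln Z_lim)
      fix x assume x: "x \<in> space P"
      have "exp (- L x) * measure \<mu> S \<le> (\<integral>z. exp (\<Psi> x z) \<partial>\<mu>)"
        using Z_lim[OF x] Z_ge[OF x] by (intro LIMSEQ_le_const) auto
      then show "(\<integral>z. exp (\<Psi> x z) \<partial>\<mu>) \<noteq> 0"
        using S_pos by (metis exp_gt_zero mult_pos_pos not_le)
    qed auto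
    show "AE x in P. norm (ln (?Z n x)) \<le> ?W x" for n
    proof (rule AE_I2)
      fix x assume x: "x \<in> space P"
      have "ln (?Z n x) \<le> ln (exp (C x) * (\<integral>z. H z \<partial>\<mu>))"
        using Z_le[OF x] Z_pos[OF x] H_pos by simp
      then have 1: "ln (?Z n x) \<le> C x + ln (\<integral>z. H z \<partial>\<mu>)"
        using H_pos by (simp add: ln_mult)
      have "ln (exp (- L x) * measure \<mu> S) \<le> ln (?Z n x)"
        using Z_ge[OF x] Z_pos[OF x] S_pos by simp
      then have 2: "- L x + ln (measure \<mu> S) \<le> ln (?Z n x)"
        using S_pos by (simp add: ln_mult)
      from 1 2 show "norm (ln (?Z n x)) \<le> ?W x"
        unfolding real_norm_def by linarith
    qed
  qed measurable
qed

text \<open>Approximating the modulus from below and restoring the sign gives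
  \<open>\<bar>d n z\<bar> \<le> \<bar>z\<bar>\<close>, so that squared norms do not increase when
  spins are replaced by their approximations.\<close>

lemma exists_simple_approximation:
  obtains d :: "nat \<Rightarrow> real \<Rightarrow> real"
  where "\<And>n. d n \<in> borel_measurable borel" "\<And>n. finite (range (d n))"
    "\<And>n z. \<bar>d n z\<bar> \<le> \<bar>z\<bar>" "\<And>z. (\<lambda>n. d n z) \<longlonglongrightarrow> z"
proof -
  obtain f :: "nat \<Rightarrow> real \<Rightarrow> real"
    where f: "incseq f" "\<And>i. simple_function borel (f i)" "\<And>x. bdd_above (range (\<lambda>i. f i x))"
      "\<And>i x. 0 \<le> f i x" "abs = (SUP i. f i)"
    using borel_measurable_implies_simple_function_sequence_real[of "abs :: real \<Rightarrow> real" borel] by auto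
  have SUP: "(SUP i. f i x) = \<bar>x\<bar>" for x
    using fun_cong[OF f(5), of x] by (simp add: image_comp)
  have le: "f i x \<le> \<bar>x\<bar>" for i x
    unfolding SUP[symmetric] by (rule cSUP_upper[OF UNIV_I f(3)])
  have lim: "(\<lambda>i. f i x) \<longlonglongrightarrow> \<bar>x\<bar>" for x
    unfolding SUP[symmetric] using f(1,3) by (intro LIMSEQ_incseq_SUP) (auto simp: incseq_def le_fun_def)
  have fin: "finite (range (f n))" and [measurable]: "f n \<in> borel_measurable borel" for n
    using f(2)[of n] by (auto simp: simple_function_def borel_measurable_simple_function)
  show ?thesis
  proof (rule that[of "\<lambda>n z. sgn z * f n z"])
    show "finite (range (\<lambda>z. sgn z * f n z))" for n
    proof (rule finite_subset)
      show "range (\<lambda>z. sgn z * f n z) \<subseteq> (\<lambda>(s, y). s * y) ` ({- 1, 0, 1} \<times> range (f n))"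
        by (auto simp: sgn_if image_iff)
    qed (use fin in auto)
    show "\<bar>sgn z * f n z\<bar> \<le> \<bar>z\<bar>" for n z
      using le[of n z] f(4)[of n z] by (auto simp: abs_mult sgn_if)
    show "(\<lambda>n. sgn z * f n z) \<longlonglongrightarrow> z" for z
      using tendsto_mult_left[OF lim[of z], of "sgn z"] by (simp add: mult.commute[of "sgn z"] abs_mult_sgn)
  qed measurable
qed

text \<open>Values of probability zero are left out so that the remaining weights are strictly
  positive, as \<open>gibbs_weights\<close> demands.\<close>

lemma (in prob_space) integral_finite_range:
  fixes f :: "'b \<Rightarrow> real"
  assumes S: "finite S" "\<And>x. x \<in> space M \<Longrightarrow> D x \<in> S"
    and D: "\<And>s. s \<in> S \<Longrightarrow> D -` {s} \<inter> space M \<in> sets M"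
  shows "(\<integral>x. f (D x) \<partial>M) =
    (\<Sum>s | s \<in> S \<and> prob (D -` {s} \<inter> space M) > 0. prob (D -` {s} \<inter> space M) * f s)"
proof -
  have "(\<integral>x. f (D x) \<partial>M) = (\<integral>x. (\<Sum>s\<in>S. f s * indicator (D -` {s} \<inter> space M) x) \<partial>M)"
  proof (rule Bochner_Integration.integral_cong[OF refl])
    fix x assume x: "x \<in> space M"
    have "(\<Sum>s\<in>S. f s * indicator (D -` {s} \<inter> space M) x) = (\<Sum>s\<in>S. if s = D x then f s else 0)"
      using x by (intro sum.cong) (auto simp: indicator_def)
    then show "f (D x) = (\<Sum>s\<in>S. f s * indicator (D -` {s} \<inter> space M) x)"
      using S x by simp
  qed
  also have "\<dots> = (\<Sum>s\<in>S. f s * prob (D -` {s} \<inter> space M))"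
    using D by (subst Bochner_Integration.integral_sum)
      (auto intro!: integrable_mult_right integrable_real_indicator simp: emeasure_eq_measure)
  also have "\<dots> = (\<Sum>s | s \<in> S \<and> prob (D -` {s} \<inter> space M) > 0. prob (D -` {s} \<inter> space M) * f s)"
    using S(1) by (intro sum.mono_neutral_cong_right) (auto simp: mult.commute less_le)
  finally show ?thesis .
qed

text \<open>Countably many sublevel sets exhaust the space, so they cannot all be null. This
  supplies the set \<open>S\<close> of \<open>ln_partition_limit\<close>.\<close>

lemma (in prob_space) exists_sublevel_pos:
  assumes [measurable]: "s \<in> borel_measurable M"
  shows "\<exists>R::real. R \<ge> 0 \<and> prob {z \<in> space M. s z \<le> R} > 0"
proof (rule ccontr)
  assume *: "\<not> ?thesis"
  have "emeasure M {z \<in> space M. s z \<le> real n} = 0" for n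
  proof -
    have "\<not> prob {z \<in> space M. s z \<le> real n} > 0"
      using * of_nat_0_le_iff by blast
    then show ?thesis
      using measure_nonneg[of M "{z \<in> space M. s z \<le> real n}"] by (simp add: emeasure_eq_measure)
  qed
  then have "emeasure M (\<Union>n. {z \<in> space M. s z \<le> real n}) = 0"
    by (intro emeasure_UN_eq_0) auto
  moreover have "(\<Union>n. {z \<in> space M. s z \<le> real n}) = space M"
    using real_arch_simple by auto
  ultimately show False
    using emeasure_space_1 by simp
qed

section \<open>The Hamiltonian and the decoupled model\<close>

definition energy :: "nat \<Rightarrow> real \<Rightarrow> real \<Rightarrow> (nat \<times> nat \<Rightarrow> real) \<Rightarrow> (nat \<Rightarrow> real) \<Rightarrow> real" where
  "energy N \<beta> lam J z = \<beta> / sqrt (2 * real N) * (\<Sum>i<N. \<Sum>j<N. J (i, j) * z i * z j)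
    - \<beta>\<^sup>2 / (4 * real N) * (\<Sum>i<N. (z i)\<^sup>2)\<^sup>2 + lam / 2 * (\<Sum>i<N. (z i)\<^sup>2)"

text \<open>The coefficient \<open>v\<close> collects both quadratic terms, the half variance of the
  field and the term in \<open>lam\<close>. It will be \<open>\<beta>\<^sup>2 * q - lam\<close>,
  with \<open>b\<close> equal to \<open>\<beta> * sqrt q\<close>, so that \<open>1 + v\<close> is
  the inverse square of \<open>sigma_RS\<close>.\<close>

definition field_energy :: "nat \<Rightarrow> real \<Rightarrow> real \<Rightarrow> (nat \<Rightarrow> real) \<Rightarrow> (nat \<Rightarrow> real) \<Rightarrow> real" where
  "field_energy N b v g z = (\<Sum>i<N. b * g i * z i - v / 2 * (z i)\<^sup>2)"

lemma prob_space_gauss_vec: "prob_space (gauss_vec N)"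
  unfolding gauss_vec_def by (intro prob_space_PiM prob_space_std_gauss)

lemma prob_space_disorder: "prob_space (disorder N)"
  unfolding disorder_def by (intro prob_space_PiM prob_space_std_gauss)

lemma measurable_gauss_vec_component [measurable]:
  "i < N \<Longrightarrow> (\<lambda>z. z i) \<in> borel_measurable (gauss_vec N)"
  unfolding gauss_vec_def by (rule measurable_PiM_std_gauss_component) simp

lemma measurable_disorder_component [measurable]:
  "i < N \<Longrightarrow> j < N \<Longrightarrow> (\<lambda>J. J (i, j)) \<in> borel_measurable (disorder N)"
  unfolding disorder_def by (rule measurable_PiM_std_gauss_component) simp

lemma measurable_energy:
  assumes "\<And>i j. i < N \<Longrightarrow> j < N \<Longrightarrow> (\<lambda>x. J x (i, j)) \<in> borel_measurable M"
    "\<And>i. i < N \<Longrightarrow> (\<lambda>x. z x i) \<in> borel_measurable M"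
  shows "(\<lambda>x. energy N \<beta> lam (J x) (z x)) \<in> borel_measurable M"
  unfolding energy_def
  by (intro borel_measurable_add borel_measurable_diff borel_measurable_times borel_measurable_const
    borel_measurable_sum borel_measurable_power assms) auto

lemma measurable_field_energy:
  assumes "\<And>i. i < N \<Longrightarrow> (\<lambda>x. g x i) \<in> borel_measurable M"
    "\<And>i. i < N \<Longrightarrow> (\<lambda>x. z x i) \<in> borel_measurable M"
  shows "(\<lambda>x. field_energy N b v (g x) (z x)) \<in> borel_measurable M"
  unfolding field_energy_def
  by (intro borel_measurable_diff borel_measurable_times borel_measurable_const
    borel_measurable_sum borel_measurable_power assms) auto

text \<open>Selecting coordinates of an i.i.d. family along an injection gives an i.i.d. family.
  With \<open>Inl\<close> and \<open>Inr\<close> this discards the half of the joint Gaussian space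
  that one endpoint does not see.\<close>

lemma integral_reindex_PiM_std_gauss:
  fixes F :: "('i \<Rightarrow> real) \<Rightarrow> real"
  assumes "inj_on f I" "f \<in> I \<rightarrow> K"
    and [measurable]: "F \<in> borel_measurable (PiM I (\<lambda>_. std_gauss))"
  shows "(\<integral>x. F (\<lambda>i\<in>I. x (f i)) \<partial>PiM K (\<lambda>_. std_gauss)) = (\<integral>y. F y \<partial>PiM I (\<lambda>_. std_gauss))"
proof -
  have "(\<lambda>x. \<lambda>i\<in>I. x (f i)) \<in> measurable (PiM K (\<lambda>_. std_gauss)) (PiM I (\<lambda>_. std_gauss))"
    using assms(2) by (intro measurable_restrict measurable_component_singleton) auto
  from integral_distr[OF this assms(3)] show ?thesis
    using distr_PiM_reindex[of K "\<lambda>_. std_gauss" f I, OF prob_space_std_gauss assms(1,2)] by simp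
qed

text \<open>The comparison is run on a disjoint sum of index sets, \<open>Inl\<close> carrying the
  couplings and \<open>Inr\<close> the field; the two coefficient families then have disjoint
  supports and are uncorrelated.\<close>

lemma discrete_comparison:
  fixes W :: "(nat \<Rightarrow> real) \<Rightarrow> real"
  assumes N: "N \<ge> 1" and q: "q \<ge> 0"
    and Om: "finite Om" "Om \<noteq> {}" "\<And>\<omega>. \<omega> \<in> Om \<Longrightarrow> W \<omega> > 0"
  shows "(\<integral>J. ln (\<Sum>\<omega>\<in>Om. W \<omega> * exp (energy N \<beta> lam J \<omega>)) \<partial>disorder N)
    \<le> (\<integral>g. ln (\<Sum>\<omega>\<in>Om. W \<omega> * exp (field_energy N (\<beta> * sqrt q) (\<beta>\<^sup>2 * q - lam) g \<omega>)) \<partial>gauss_vec N)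
      + real N * (\<beta>\<^sup>2 / 4 * q\<^sup>2)"
proof -
  let ?I = "{..<N} \<times> {..<N}"
  let ?K = "?I <+> {..<N}"
  let ?P = "PiM ?K (\<lambda>_. std_gauss)"
  let ?s = "\<lambda>\<omega>::nat \<Rightarrow> real. \<Sum>i<N. (\<omega> i)\<^sup>2"
  define a :: "(nat \<times> nat) + nat \<Rightarrow> (nat \<Rightarrow> real) \<Rightarrow> real" where
    "a k \<omega> = (case k of Inl (i, j) \<Rightarrow> \<beta> / sqrt (2 * real N) * (\<omega> i * \<omega> j) | Inr i \<Rightarrow> 0)" for k \<omega>
  define b :: "(nat \<times> nat) + nat \<Rightarrow> (nat \<Rightarrow> real) \<Rightarrow> real" where
    "b k \<omega> = (case k of Inl p \<Rightarrow> 0 | Inr i \<Rightarrow> \<beta> * sqrt q * \<omega> i)" for k \<omega>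
  \<comment> \<open>The term in \<open>lam\<close> is deterministic and common to both endpoints, so
    it is hidden in the weights and leaves the Gaussian parts centred.\<close>
  define w where "w \<omega> = W \<omega> * exp (lam / 2 * ?s \<omega>)" for \<omega>
  have sumK: "(\<Sum>k\<in>?K. u k) = (\<Sum>i<N. \<Sum>j<N. u (Inl (i, j))) + (\<Sum>i<N. u (Inr i))" for u :: "_ \<Rightarrow> real"
    by (simp add: sum.Plus sum.cartesian_product' comp_def)
  have Np: "real N > 0" using N by simp
  have aa: "(\<Sum>k\<in>?K. a k \<omega> * a k \<omega>') = \<beta>\<^sup>2 / (2 * real N) * (\<Sum>i<N. \<omega> i * \<omega>' i)\<^sup>2" for \<omega> \<omega>'
  proof -
    have "(\<Sum>k\<in>?K. a k \<omega> * a k \<omega>') = (\<Sum>i<N. \<Sum>j<N. \<beta>\<^sup>2 / (2 * real N) * ((\<omega> i * \<omega>' i) * (\<omega> j * \<omega>' j)))"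
      unfolding sumK using Np by (simp add: a_def) (simp add: field_simps power2_eq_square)
    also have "\<dots> = \<beta>\<^sup>2 / (2 * real N) * (\<Sum>i<N. \<omega> i * \<omega>' i)\<^sup>2"
      unfolding power2_eq_square[of "sum _ _"] sum_product by (simp add: sum_distrib_left)
    finally show ?thesis .
  qed
  have bb: "(\<Sum>k\<in>?K. b k \<omega> * b k \<omega>') = \<beta>\<^sup>2 * q * (\<Sum>i<N. \<omega> i * \<omega>' i)" for \<omega> \<omega>'
  proof -
    have "(\<Sum>k\<in>?K. b k \<omega> * b k \<omega>') = (\<Sum>i<N. (\<beta>\<^sup>2 * (sqrt q)\<^sup>2) * (\<omega> i * \<omega>' i))"
    proof -
      have *: "\<beta> * sqrt q * \<omega> i * (\<beta> * sqrt q * \<omega>' i) = (\<beta>\<^sup>2 * (sqrt q)\<^sup>2) * (\<omega> i * \<omega>' i)" for i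
        by algebra
      show ?thesis
        unfolding sumK by (simp add: b_def) (simp only: *)
    qed
    then show ?thesis
      using q by (simp add: sum_distrib_left)
  qed
  \<comment> \<open>Minus the minimum over \<open>r\<close> of \<open>\<beta>\<^sup>2 / (2 * real N)
    * r\<^sup>2 - \<beta>\<^sup>2 * q * r\<close>, attained at overlap
    \<open>r = q * real N\<close>. Half of it is \<open>N\<close> times the last term of
    \<open>A_tilde\<close>.\<close>
  define m where "m = \<beta>\<^sup>2 * q\<^sup>2 * real N / 2"
  interpret gaussian_interpolation Om w ?K a b m
  proof
    show "w \<omega> > 0" if "\<omega> \<in> Om" for \<omega>
      unfolding w_def using Om(3)[OF that] by simp
    show "(\<Sum>k\<in>?K. a k \<omega> * b k \<omega>') = 0" for \<omega> \<omega>'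
      unfolding sumK by (simp add: a_def b_def)
    show "(\<Sum>k\<in>?K. a k \<omega> * a k \<omega>') - (\<Sum>k\<in>?K. b k \<omega> * b k \<omega>') \<ge> - m" for \<omega> \<omega>'
    proof -
      define r where "r = (\<Sum>i<N. \<omega> i * \<omega>' i)"
      define \<kappa> where "\<kappa> = \<beta>\<^sup>2 / (2 * real N)"
      have \<kappa>: "\<beta>\<^sup>2 = 2 * (\<kappa> * real N)" unfolding \<kappa>_def using Np by simp
      have "\<kappa> * r\<^sup>2 - \<beta>\<^sup>2 * q * r + m = \<kappa> * (r - q * real N)\<^sup>2"
        unfolding m_def \<kappa> by (simp add: algebra_simps power2_eq_square)
      also have "\<dots> \<ge> 0" unfolding \<kappa>_def using Np by simp
      finally have "\<beta>\<^sup>2 / (2 * real N) * r\<^sup>2 - \<beta>\<^sup>2 * q * r + m \<ge> 0" unfolding \<kappa>_def .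
      then show ?thesis unfolding aa bb r_def by simp
    qed
  qed (use Om in auto)
  have "(\<integral>x. ln (\<Sum>\<omega>\<in>Om. w \<omega> * exp ((\<Sum>k\<in>?K. a k \<omega> * x k) - 1/2 * (\<Sum>k\<in>?K. (a k \<omega>)\<^sup>2))) \<partial>?P)
    = (\<integral>x. ln (\<Sum>\<omega>\<in>Om. W \<omega> * exp (energy N \<beta> lam (\<lambda>p\<in>?I. x (Inl p)) \<omega>)) \<partial>?P)"
  proof (intro Bochner_Integration.integral_cong refl arg_cong[where f = ln] sum.cong)
    fix x \<omega>
    have 1: "(\<Sum>k\<in>?K. a k \<omega> * x k) = \<beta> / sqrt (2 * real N) * (\<Sum>i<N. \<Sum>j<N. (\<lambda>p\<in>?I. x (Inl p)) (i, j) * \<omega> i * \<omega> j)"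
      unfolding sumK by (simp add: a_def sum_distrib_left mult_ac)
    have 2: "1/2 * (\<Sum>k\<in>?K. (a k \<omega>)\<^sup>2) = \<beta>\<^sup>2 / (4 * real N) * (?s \<omega>)\<^sup>2"
      unfolding power2_eq_square[of "a _ _"] aa power2_eq_square[of "\<omega> _"] by simp
    show "w \<omega> * exp ((\<Sum>k\<in>?K. a k \<omega> * x k) - 1/2 * (\<Sum>k\<in>?K. (a k \<omega>)\<^sup>2)) =
      W \<omega> * exp (energy N \<beta> lam (\<lambda>p\<in>?I. x (Inl p)) \<omega>)"
      unfolding 1 2 w_def energy_def by (simp add: exp_add)
  qed
  also have "\<dots> = (\<integral>J. ln (\<Sum>\<omega>\<in>Om. W \<omega> * exp (energy N \<beta> lam J \<omega>)) \<partial>disorder N)"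
  proof -
    have [measurable]: "(\<lambda>J. energy N \<beta> lam J \<omega>) \<in> borel_measurable (disorder N)" for \<omega>
      by (rule measurable_energy) (simp_all add: measurable_disorder_component)
    have "inj_on Inl ?I" "Inl \<in> ?I \<rightarrow> ?K" by auto
    moreover have "(\<lambda>J. ln (\<Sum>\<omega>\<in>Om. W \<omega> * exp (energy N \<beta> lam J \<omega>))) \<in> borel_measurable (disorder N)"
      by measurable
    ultimately show ?thesis
      unfolding disorder_def by (rule integral_reindex_PiM_std_gauss)
  qed
  finally have L: "(\<integral>x. ln (\<Sum>\<omega>\<in>Om. w \<omega> * exp ((\<Sum>k\<in>?K. a k \<omega> * x k) - 1/2 * (\<Sum>k\<in>?K. (a k \<omega>)\<^sup>2))) \<partial>?P)
    = (\<integral>J. ln (\<Sum>\<omega>\<in>Om. W \<omega> * exp (energy N \<beta> lam J \<omega>)) \<partial>disorder N)" .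
  let ?E = "field_energy N (\<beta> * sqrt q) (\<beta>\<^sup>2 * q - lam)"
  have "(\<integral>x. ln (\<Sum>\<omega>\<in>Om. w \<omega> * exp ((\<Sum>k\<in>?K. b k \<omega> * x k) - 1/2 * (\<Sum>k\<in>?K. (b k \<omega>)\<^sup>2))) \<partial>?P)
    = (\<integral>x. ln (\<Sum>\<omega>\<in>Om. W \<omega> * exp (?E (\<lambda>i\<in>{..<N}. x (Inr i)) \<omega>)) \<partial>?P)"
  proof (intro Bochner_Integration.integral_cong refl arg_cong[where f = ln] sum.cong)
    fix x \<omega>
    have 2: "1/2 * (\<Sum>k\<in>?K. (b k \<omega>)\<^sup>2) = \<beta>\<^sup>2 * q / 2 * ?s \<omega>"
      unfolding power2_eq_square[of "b _ _"] bb power2_eq_square[of "\<omega> _"] by simp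
    have "?E (\<lambda>i\<in>{..<N}. x (Inr i)) \<omega> = (\<Sum>k\<in>?K. b k \<omega> * x k) - (\<beta>\<^sup>2 * q - lam) / 2 * ?s \<omega>"
      unfolding sumK by (simp add: b_def field_energy_def sum_distrib_left sum_subtractf mult_ac)
    also have "\<dots> = (\<Sum>k\<in>?K. b k \<omega> * x k) - 1/2 * (\<Sum>k\<in>?K. (b k \<omega>)\<^sup>2) + lam / 2 * ?s \<omega>"
      unfolding 2 by (simp add: algebra_simps diff_divide_distrib)
    finally show "w \<omega> * exp ((\<Sum>k\<in>?K. b k \<omega> * x k) - 1/2 * (\<Sum>k\<in>?K. (b k \<omega>)\<^sup>2)) =
      W \<omega> * exp (?E (\<lambda>i\<in>{..<N}. x (Inr i)) \<omega>)"
      unfolding w_def by (simp add: exp_add)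
  qed
  also have "\<dots> = (\<integral>g. ln (\<Sum>\<omega>\<in>Om. W \<omega> * exp (?E g \<omega>)) \<partial>gauss_vec N)"
  proof -
    have [measurable]: "(\<lambda>g. ?E g \<omega>) \<in> borel_measurable (gauss_vec N)" for \<omega>
      by (rule measurable_field_energy) (simp_all add: measurable_gauss_vec_component)
    have "inj_on Inr {..<N}" "Inr \<in> {..<N} \<rightarrow> ?K" by auto
    moreover have "(\<lambda>g. ln (\<Sum>\<omega>\<in>Om. W \<omega> * exp (?E g \<omega>))) \<in> borel_measurable (gauss_vec N)"
      by measurable
    ultimately show ?thesis
      unfolding gauss_vec_def by (rule integral_reindex_PiM_std_gauss)
  qed
  finally have R: "(\<integral>x. ln (\<Sum>\<omega>\<in>Om. w \<omega> * exp ((\<Sum>k\<in>?K. b k \<omega> * x k) - 1/2 * (\<Sum>k\<in>?K. (b k \<omega>)\<^sup>2))) \<partial>?P)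
    = (\<integral>g. ln (\<Sum>\<omega>\<in>Om. W \<omega> * exp (?E g \<omega>)) \<partial>gauss_vec N)" .
  have "m / 2 = real N * (\<beta>\<^sup>2 / 4 * q\<^sup>2)"
    unfolding m_def by simp
  then show ?thesis
    using gaussian_comparison unfolding L R by (simp only:)
qed

lemma simple_comparison:
  assumes N: "N \<ge> 1" and q: "q \<ge> 0"
    and d: "d \<in> borel_measurable borel" "finite (range d)"
  shows "(\<integral>J. ln (\<integral>z. exp (energy N \<beta> lam J (\<lambda>i. d (z i))) \<partial>gauss_vec N) \<partial>disorder N)
    \<le> (\<integral>g. ln (\<integral>z. exp (field_energy N (\<beta> * sqrt q) (\<beta>\<^sup>2 * q - lam) g (\<lambda>i. d (z i))) \<partial>gauss_vec N) \<partial>gauss_vec N)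
      + real N * (\<beta>\<^sup>2 / 4 * q\<^sup>2)"
proof -
  interpret \<mu>: prob_space "gauss_vec N" by (rule prob_space_gauss_vec)
  note [measurable] = d(1)
  \<comment> \<open>Restricting to the first \<open>N\<close> sites makes \<open>D\<close>
    extensional, so its values lie in a finite \<open>PiE\<close> set. The energies read only these
    sites and do not notice the restriction.\<close>
  define D :: "(nat \<Rightarrow> real) \<Rightarrow> nat \<Rightarrow> real" where "D z = (\<lambda>i\<in>{..<N}. d (z i))" for z
  define S where "S = PiE {..<N} (\<lambda>_. range d)"
  define W where "W \<omega> = \<mu>.prob (D -` {\<omega>} \<inter> space (gauss_vec N))" for \<omega>
  have S: "finite S" unfolding S_def using d(2) by (intro finite_PiE) auto
  have DS: "D z \<in> S" for z unfolding D_def S_def by auto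
  have "D -` {\<omega>} \<inter> space (gauss_vec N) = {z \<in> space (gauss_vec N). \<forall>i<N. d (z i) = \<omega> i}" if "\<omega> \<in> S" for \<omega>
    using that unfolding D_def S_def by (auto simp: fun_eq_iff PiE_def extensional_def)
  then have D: "D -` {\<omega>} \<inter> space (gauss_vec N) \<in> sets (gauss_vec N)" if "\<omega> \<in> S" for \<omega>
    using that by simp
  note fin = \<mu>.integral_finite_range[OF S DS D, folded W_def]
  let ?Om = "{\<omega> \<in> S. W \<omega> > 0}"
  have W1: "(\<Sum>\<omega>\<in>?Om. W \<omega>) = 1"
    using fin[of "\<lambda>_. 1"] \<mu>.prob_space by simp
  have Om: "?Om \<noteq> {}"
  proof
    assume "?Om = {}"
    from W1[unfolded this] show False by simp
  qed
  have e: "energy N \<beta> lam J (D z) = energy N \<beta> lam J (\<lambda>i. d (z i))" for J z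
    unfolding energy_def D_def by simp
  have f: "field_energy N b v g (D z) = field_energy N b v g (\<lambda>i. d (z i))" for b v g z
    unfolding field_energy_def D_def by simp
  have 1: "(\<Sum>\<omega>\<in>?Om. W \<omega> * exp (energy N \<beta> lam J \<omega>)) =
      (\<integral>z. exp (energy N \<beta> lam J (\<lambda>i. d (z i))) \<partial>gauss_vec N)" for J
    using fin[of "\<lambda>\<omega>. exp (energy N \<beta> lam J \<omega>)"] unfolding e by (rule sym)
  have 2: "(\<Sum>\<omega>\<in>?Om. W \<omega> * exp (field_energy N b v g \<omega>)) =
      (\<integral>z. exp (field_energy N b v g (\<lambda>i. d (z i))) \<partial>gauss_vec N)" for b v g
    using fin[of "\<lambda>\<omega>. exp (field_energy N b v g \<omega>)"] unfolding f by (rule sym)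
  have fin_Om: "finite ?Om"
    using S by (rule rev_finite_subset) (rule Collect_restrict)
  have W_pos: "W \<omega> > 0" if "\<omega> \<in> ?Om" for \<omega>
    using that by simp
  have "(\<integral>J. ln (\<Sum>\<omega>\<in>?Om. W \<omega> * exp (energy N \<beta> lam J \<omega>)) \<partial>disorder N)
    \<le> (\<integral>g. ln (\<Sum>\<omega>\<in>?Om. W \<omega> * exp (field_energy N (\<beta> * sqrt q) (\<beta>\<^sup>2 * q - lam) g \<omega>)) \<partial>gauss_vec N)
      + real N * (\<beta>\<^sup>2 / 4 * q\<^sup>2)"
    by (rule discrete_comparison[OF N q fin_Om Om W_pos])
  then show ?thesis
    unfolding 1 2 .
qed

section \<open>Energy bounds and removal of the cutoff\<close>

lemma AM_GM_square:
  fixes x y \<delta> :: real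
  assumes "\<delta> > 0"
  shows "x * y \<le> x\<^sup>2 / \<delta> + \<delta> / 4 * y\<^sup>2"
proof -
  have "x\<^sup>2 / \<delta> + \<delta> / 4 * y\<^sup>2 - x * y = (x - \<delta> / 2 * y)\<^sup>2 / \<delta>"
    using assms by (simp add: field_simps power2_eq_square)
  also have "\<dots> \<ge> 0" using assms by simp
  finally show ?thesis by simp
qed

lemma interaction_bound:
  fixes J :: "nat \<times> nat \<Rightarrow> real" and z :: "nat \<Rightarrow> real"
  shows "\<bar>\<Sum>i<N. \<Sum>j<N. J (i, j) * z i * z j\<bar> \<le> (\<Sum>i<N. \<Sum>j<N. \<bar>J (i, j)\<bar>) * (\<Sum>i<N. (z i)\<^sup>2)"
  unfolding sum_distrib_right
proof (intro order_trans[OF sum_abs] sum_mono)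
  fix i j assume ij: "i \<in> {..<N}" "j \<in> {..<N}"
  have sq: "(z i)\<^sup>2 \<le> (\<Sum>i<N. (z i)\<^sup>2)" "(z j)\<^sup>2 \<le> (\<Sum>i<N. (z i)\<^sup>2)"
    using ij by (auto intro!: member_le_sum)
  have "0 \<le> (\<bar>z i\<bar> - \<bar>z j\<bar>)\<^sup>2" by simp
  then have "2 * (\<bar>z i\<bar> * \<bar>z j\<bar>) \<le> (z i)\<^sup>2 + (z j)\<^sup>2"
    by (simp add: power2_diff)
  then have "\<bar>z i\<bar> * \<bar>z j\<bar> \<le> (\<Sum>i<N. (z i)\<^sup>2)"
    using sq by linarith
  from mult_left_mono[OF this, of "\<bar>J (i, j)\<bar>"]
  show "\<bar>J (i, j) * z i * z j\<bar> \<le> \<bar>J (i, j)\<bar> * (\<Sum>i<N. (z i)\<^sup>2)"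
    by (simp add: abs_mult mult.assoc)
qed

text \<open>The energy is at most \<open>?A * s - \<kappa> * s\<^sup>2\<close> in the squared norm
  \<open>s\<close>, which is bounded uniformly in the spins; hence a constant \<open>H\<close>
  suffices. The bound is quadratic in the couplings and therefore integrable.\<close>

lemma energy_limit:
  assumes N: "N \<ge> 1" and \<beta>: "\<beta> > 0"
    and d: "\<And>n. d n \<in> borel_measurable borel" "\<And>n z. \<bar>d n z\<bar> \<le> \<bar>z\<bar>" "\<And>z. (\<lambda>n. d n z) \<longlonglongrightarrow> z"
  shows "(\<lambda>n. \<integral>J. ln (\<integral>z. exp (energy N \<beta> lam J (\<lambda>i. d n (z i))) \<partial>gauss_vec N) \<partial>disorder N)
    \<longlonglongrightarrow> (\<integral>J. ln (\<integral>z. exp (energy N \<beta> lam J z) \<partial>gauss_vec N) \<partial>disorder N)"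
proof -
  interpret \<mu>: prob_space "gauss_vec N" by (rule prob_space_gauss_vec)
  let ?s = "\<lambda>z::nat \<Rightarrow> real. \<Sum>i<N. (z i)\<^sup>2"
  let ?T = "\<lambda>J::nat \<times> nat \<Rightarrow> real. \<Sum>i<N. \<Sum>j<N. \<bar>J (i, j)\<bar>"
  let ?T2 = "\<lambda>J::nat \<times> nat \<Rightarrow> real. \<Sum>i<N. \<Sum>j<N. (J (i, j))\<^sup>2"
  define \<kappa> where "\<kappa> = \<beta>\<^sup>2 / (4 * real N)"
  define \<eta> where "\<eta> = \<beta> / sqrt (2 * real N)"
  have Np: "real N > 0" using N by simp
  have \<kappa>: "\<kappa> > 0" and \<eta>: "\<eta> > 0" using Np \<beta> by (auto simp: \<kappa>_def \<eta>_def)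
  have s_meas: "?s \<in> borel_measurable (gauss_vec N)"
    by (intro borel_measurable_sum borel_measurable_power measurable_gauss_vec_component) auto
  obtain R where R: "R \<ge> 0" "\<mu>.prob {z \<in> space (gauss_vec N). ?s z \<le> R} > 0"
    using \<mu>.exists_sublevel_pos[OF s_meas] by auto
  have s0: "?s z \<ge> 0" for z by (intro sum_nonneg) auto
  have T0: "?T J \<ge> 0" for J by (intro sum_nonneg) auto
  have sd: "?s (\<lambda>i. d n (z i)) \<le> ?s z" for n and z :: "nat \<Rightarrow> real"
    using d(2) by (intro sum_mono) (simp add: abs_le_square_iff)
  have e_eq: "energy N \<beta> lam J z = \<eta> * (\<Sum>i<N. \<Sum>j<N. J (i, j) * z i * z j) - \<kappa> * (?s z)\<^sup>2 + lam / 2 * ?s z" for J z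
    by (simp add: energy_def \<eta>_def \<kappa>_def)
  have H: "\<bar>\<eta> * (\<Sum>i<N. \<Sum>j<N. J (i, j) * z i * z j)\<bar> \<le> \<eta> * ?T J * ?s z" for J z
    using mult_left_mono[OF interaction_bound[of J z N], of \<eta>] \<eta> by (simp add: abs_mult mult.assoc)
  have Ls: "\<bar>lam / 2 * ?s z\<bar> \<le> \<bar>lam\<bar> / 2 * ?s z" for z
    using s0[of z] by (simp add: abs_mult)
  have ub: "energy N \<beta> lam J z \<le> (\<eta>\<^sup>2 * (real N)\<^sup>2 * ?T2 J + lam\<^sup>2 / 4) / (2 * \<kappa>)" for J z
  proof -
    \<comment> \<open>Cauchy-Schwarz over the \<open>N * N\<close> couplings replaces the square of
      a sum by a sum of squares, whose integrability can be read off coordinate by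
      coordinate.\<close>
    have T2: "(?T J)\<^sup>2 \<le> (real N)\<^sup>2 * ?T2 J"
    proof -
      have "(?T J)\<^sup>2 = (\<Sum>p\<in>{..<N} \<times> {..<N}. \<bar>J p\<bar>)\<^sup>2"
        by (simp add: sum.cartesian_product')
      also have "\<dots> \<le> (\<Sum>p\<in>{..<N} \<times> {..<N}. \<bar>J p\<bar>\<^sup>2) * real (card ({..<N} \<times> {..<N}))"
        by (rule sum_squared_le_sum_of_squares)
      also have "\<dots> = (real N)\<^sup>2 * ?T2 J"
        by (simp add: sum.cartesian_product' power2_eq_square)
      finally show ?thesis .
    qed
    let ?A = "\<eta> * ?T J + \<bar>lam\<bar> / 2"
    have "energy N \<beta> lam J z \<le> ?A * ?s z - \<kappa> * (?s z)\<^sup>2"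
      unfolding e_eq using H[of J z] Ls[of z] by (simp add: distrib_right)
    \<comment> \<open>With parameter \<open>4 * \<kappa>\<close> the remainder in
      \<open>AM_GM_square\<close> is exactly the quartic term.\<close>
    also have "\<dots> \<le> ?A\<^sup>2 / (4 * \<kappa>)"
      using AM_GM_square[of "4 * \<kappa>" ?A "?s z"] \<kappa> by simp
    also have "\<dots> \<le> (2 * (\<eta>\<^sup>2 * (?T J)\<^sup>2) + 2 * (lam\<^sup>2 / 4)) / (4 * \<kappa>)"
    proof (intro divide_right_mono)
      have "0 \<le> (\<eta> * ?T J - \<bar>lam\<bar> / 2)\<^sup>2" by simp
      then show "?A\<^sup>2 \<le> 2 * (\<eta>\<^sup>2 * (?T J)\<^sup>2) + 2 * (lam\<^sup>2 / 4)"
        unfolding power2_sum power2_diff by (simp add: power_mult_distrib power_divide)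
    qed (use \<kappa> in simp)
    also have "\<dots> = (\<eta>\<^sup>2 * (?T J)\<^sup>2 + lam\<^sup>2 / 4) / (2 * \<kappa>)"
      using \<kappa> by (simp add: field_simps)
    also have "\<dots> \<le> (\<eta>\<^sup>2 * ((real N)\<^sup>2 * ?T2 J) + lam\<^sup>2 / 4) / (2 * \<kappa>)"
      using \<kappa> T2 by (intro divide_right_mono add_right_mono mult_left_mono) auto
    finally show ?thesis by (simp add: mult.assoc)
  qed
  have T_int: "integrable (disorder N) ?T"
    unfolding disorder_def
    by (intro Bochner_Integration.integrable_sum integrable_PiM_std_gauss_component)
      (use integrable_abs[OF integrable_std_gauss_power[of 1]] in auto)
  have T2_int: "integrable (disorder N) ?T2"
    unfolding disorder_def
    by (intro Bochner_Integration.integrable_sum integrable_PiM_std_gauss_component[where f = "\<lambda>x. x\<^sup>2"]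
      integrable_std_gauss_power) auto
  have const: "integrable (disorder N) (\<lambda>_. c)" for c :: real
    by (rule finite_measure.integrable_const[OF prob_space.finite_measure[OF prob_space_disorder]])
  have fst_meas: "(\<lambda>x. fst x (i, j)) \<in> borel_measurable (disorder N \<Otimes>\<^sub>M gauss_vec N)" if "i < N" "j < N" for i j
    using that by (intro measurable_compose[OF measurable_fst measurable_disorder_component])
  have snd_meas: "(\<lambda>x. snd x i) \<in> borel_measurable (disorder N \<Otimes>\<^sub>M gauss_vec N)" if "i < N" for i
    using that by (intro measurable_compose[OF measurable_snd measurable_gauss_vec_component])
  have d_meas: "(\<lambda>x. d n (snd x i)) \<in> borel_measurable (disorder N \<Otimes>\<^sub>M gauss_vec N)" if "i < N" for n i
    by (rule measurable_compose[OF snd_meas[OF that] d(1)])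
  show ?thesis
  proof (rule ln_partition_limit[where \<mu> = "gauss_vec N" and P = "disorder N"
        and \<Phi> = "\<lambda>n J z. energy N \<beta> lam J (\<lambda>i. d n (z i))" and \<Psi> = "\<lambda>J z. energy N \<beta> lam J z"
        and H = "\<lambda>_. 1" and S = "{z \<in> space (gauss_vec N). ?s z \<le> R}"
        and C = "\<lambda>J. (\<eta>\<^sup>2 * (real N)\<^sup>2 * ?T2 J + lam\<^sup>2 / 4) / (2 * \<kappa>)"
        and L = "\<lambda>J. \<eta> * ?T J * R + (\<kappa> * R\<^sup>2 + \<bar>lam\<bar> / 2 * R)"])
    show "(\<lambda>(J, z). energy N \<beta> lam J (\<lambda>i. d n (z i))) \<in> borel_measurable (disorder N \<Otimes>\<^sub>M gauss_vec N)" for n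
      unfolding case_prod_unfold
      by (rule measurable_energy) (simp_all add: fst_meas d_meas)
    show "(\<lambda>(J, z). energy N \<beta> lam J z) \<in> borel_measurable (disorder N \<Otimes>\<^sub>M gauss_vec N)"
      unfolding case_prod_unfold
      by (rule measurable_energy) (simp_all add: fst_meas snd_meas)
    show "(\<lambda>n. energy N \<beta> lam J (\<lambda>i. d n (z i))) \<longlonglongrightarrow> energy N \<beta> lam J z" for J z
      unfolding e_eq by (intro tendsto_intros d(3))
    show "exp (energy N \<beta> lam J (\<lambda>i. d n (z i))) \<le> exp ((\<eta>\<^sup>2 * (real N)\<^sup>2 * ?T2 J + lam\<^sup>2 / 4) / (2 * \<kappa>)) * 1" for n J z
      using ub by simp
    show "integrable (gauss_vec N) (\<lambda>_. 1 :: real)"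
      by (rule \<mu>.integrable_const)
    show "{z \<in> space (gauss_vec N). ?s z \<le> R} \<in> sets (gauss_vec N)"
      using s_meas by measurable
    show "- (\<eta> * ?T J * R + (\<kappa> * R\<^sup>2 + \<bar>lam\<bar> / 2 * R)) \<le> energy N \<beta> lam J (\<lambda>i. d n (z i))"
      if "z \<in> {z \<in> space (gauss_vec N). ?s z \<le> R}" for n J z
    proof -
      let ?z = "\<lambda>i. d n (z i)"
      have s: "?s ?z \<le> R" using sd[of n z] that by simp
      have "\<eta> * ?T J * ?s ?z \<le> \<eta> * ?T J * R"
        using s T0[of J] \<eta> by (intro mult_left_mono) auto
      moreover have "\<kappa> * (?s ?z)\<^sup>2 \<le> \<kappa> * R\<^sup>2"
        using s s0[of ?z] \<kappa> by (intro mult_left_mono power_mono) auto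
      moreover have "\<bar>lam\<bar> / 2 * ?s ?z \<le> \<bar>lam\<bar> / 2 * R"
        using s by (intro mult_left_mono) auto
      ultimately show ?thesis
        unfolding e_eq using H[of J ?z] Ls[of ?z] by linarith
    qed
    show "integrable (disorder N) (\<lambda>J. (\<eta>\<^sup>2 * (real N)\<^sup>2 * ?T2 J + lam\<^sup>2 / 4) / (2 * \<kappa>))"
      by (intro integrable_divide Bochner_Integration.integrable_add integrable_mult_right T2_int const)
    show "integrable (disorder N) (\<lambda>J. \<eta> * ?T J * R + (\<kappa> * R\<^sup>2 + \<bar>lam\<bar> / 2 * R))"
      by (intro Bochner_Integration.integrable_add integrable_mult_left integrable_mult_right T_int const)
  qed (use R in \<open>auto intro: prob_space_gauss_vec prob_space_disorder\<close>)
qed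

text \<open>With no quartic term available, the domination must come from the Gaussian measure of
  the spins itself: \<open>v > - 1\<close> leaves a margin in its quadratic decay, part of which is
  spent on the linear field term.\<close>

lemma field_energy_limit:
  assumes v: "v > - 1"
    and d: "\<And>n. d n \<in> borel_measurable borel" "\<And>n z. \<bar>d n z\<bar> \<le> \<bar>z\<bar>" "\<And>z. (\<lambda>n. d n z) \<longlonglongrightarrow> z"
  shows "(\<lambda>n. \<integral>g. ln (\<integral>z. exp (field_energy N b v g (\<lambda>i. d n (z i))) \<partial>gauss_vec N) \<partial>gauss_vec N)
    \<longlonglongrightarrow> (\<integral>g. ln (\<integral>z. exp (field_energy N b v g z) \<partial>gauss_vec N) \<partial>gauss_vec N)"
proof -
  interpret \<mu>: prob_space "gauss_vec N" by (rule prob_space_gauss_vec)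
  let ?s = "\<lambda>z::nat \<Rightarrow> real. \<Sum>i<N. (z i)\<^sup>2"
  \<comment> \<open>The margin is \<open>1 + v\<close>, capped at \<open>1\<close>. The cap keeps
    \<open>1 / 2 - \<delta> / 4\<close> non-negative, so that the approximating spin may be replaced
    by the larger \<open>z i\<close> in the upper bound.\<close>
  define \<delta> where "\<delta> = 1 - max (- v) 0"
  have \<delta>: "\<delta> > 0" "\<delta> \<le> 1" "- v \<le> 1 - \<delta>" using v by (auto simp: \<delta>_def)
  have s_meas: "?s \<in> borel_measurable (gauss_vec N)"
    by (intro borel_measurable_sum borel_measurable_power measurable_gauss_vec_component) auto
  obtain R where R: "R \<ge> 0" "\<mu>.prob {z \<in> space (gauss_vec N). ?s z \<le> R} > 0"
    using \<mu>.exists_sublevel_pos[OF s_meas] by auto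
  have sq: "(d n y)\<^sup>2 \<le> y\<^sup>2" for n y
    using d(2) by (simp add: abs_le_square_iff)
  have sd: "?s (\<lambda>i. d n (z i)) \<le> ?s z" for n and z :: "nat \<Rightarrow> real"
    using sq by (intro sum_mono)
  have s_int: "integrable (gauss_vec N) ?s"
    unfolding gauss_vec_def
    by (intro Bochner_Integration.integrable_sum integrable_PiM_std_gauss_component[where f = "\<lambda>x. x\<^sup>2"]
      integrable_std_gauss_power) auto
  \<comment> \<open>The linear term costs \<open>\<delta> / 4\<close> of the margin
    \<open>\<delta> / 2\<close>. The bound is written in the form of
    \<open>integrable_exp_std_gauss\<close> with \<open>y = 0\<close> and
    \<open>u = \<delta> / 2\<close>, still positive.\<close>
  have ub: "field_energy N b v g (\<lambda>i. d n (z i)) \<le> b\<^sup>2 / \<delta> * ?s g + (\<Sum>i<N. 0 * z i - (\<delta> / 2 - 1) / 2 * (z i)\<^sup>2)" for n g z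
    unfolding field_energy_def sum_distrib_left sum.distrib[symmetric]
  proof (rule sum_mono)
    fix i
    let ?y = "d n (z i)"
    have "b * g i * ?y \<le> b\<^sup>2 / \<delta> * (g i)\<^sup>2 + \<delta> / 4 * ?y\<^sup>2"
      using AM_GM_square[OF \<delta>(1), of "b * g i" ?y] by (simp add: power_mult_distrib)
    moreover have "- v / 2 * ?y\<^sup>2 \<le> (1 - \<delta>) / 2 * ?y\<^sup>2"
      using \<delta> by (intro mult_right_mono) auto
    moreover have "(1 / 2 - \<delta> / 4) * ?y\<^sup>2 \<le> (1 / 2 - \<delta> / 4) * (z i)\<^sup>2"
      using \<delta> by (intro mult_left_mono sq) auto
    ultimately show "b * g i * ?y - v / 2 * ?y\<^sup>2 \<le> b\<^sup>2 / \<delta> * (g i)\<^sup>2 + (0 * z i - (\<delta> / 2 - 1) / 2 * (z i)\<^sup>2)"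
      by (simp add: field_simps)
  qed
  have H_int: "integrable (gauss_vec N) (\<lambda>z. exp (\<Sum>i<N. 0 * z i - (\<delta> / 2 - 1) / 2 * (z i)\<^sup>2))"
    unfolding gauss_vec_def exp_sum[OF finite_lessThan]
    using \<delta> by (intro std_gauss_prod.product_integrable_prod integrable_exp_std_gauss) auto
  have const: "integrable (gauss_vec N) (\<lambda>_. c)" for c :: real
    by (rule \<mu>.integrable_const)
  have fst_meas: "(\<lambda>x. fst x i) \<in> borel_measurable (gauss_vec N \<Otimes>\<^sub>M gauss_vec N)" if "i < N" for i
    using that by (intro measurable_compose[OF measurable_fst measurable_gauss_vec_component])
  have snd_meas: "(\<lambda>x. snd x i) \<in> borel_measurable (gauss_vec N \<Otimes>\<^sub>M gauss_vec N)" if "i < N" for i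
    using that by (intro measurable_compose[OF measurable_snd measurable_gauss_vec_component])
  have d_meas: "(\<lambda>x. d n (snd x i)) \<in> borel_measurable (gauss_vec N \<Otimes>\<^sub>M gauss_vec N)" if "i < N" for n i
    by (rule measurable_compose[OF snd_meas[OF that] d(1)])
  show ?thesis
  proof (rule ln_partition_limit[where \<mu> = "gauss_vec N" and P = "gauss_vec N"
        and \<Phi> = "\<lambda>n g z. field_energy N b v g (\<lambda>i. d n (z i))" and \<Psi> = "\<lambda>g z. field_energy N b v g z"
        and H = "\<lambda>z. exp (\<Sum>i<N. 0 * z i - (\<delta> / 2 - 1) / 2 * (z i)\<^sup>2)"
        and S = "{z \<in> space (gauss_vec N). ?s z \<le> R}"
        and C = "\<lambda>g. b\<^sup>2 / \<delta> * ?s g" and L = "\<lambda>g. b\<^sup>2 * ?s g + (1 / 4 + \<bar>v\<bar> / 2) * R"])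
    show "(\<lambda>(g, z). field_energy N b v g (\<lambda>i. d n (z i))) \<in> borel_measurable (gauss_vec N \<Otimes>\<^sub>M gauss_vec N)" for n
      unfolding case_prod_unfold
      by (rule measurable_field_energy) (simp_all add: fst_meas d_meas)
    show "(\<lambda>(g, z). field_energy N b v g z) \<in> borel_measurable (gauss_vec N \<Otimes>\<^sub>M gauss_vec N)"
      unfolding case_prod_unfold
      by (rule measurable_field_energy) (simp_all add: fst_meas snd_meas)
    show "(\<lambda>n. field_energy N b v g (\<lambda>i. d n (z i))) \<longlonglongrightarrow> field_energy N b v g z" for g z
      unfolding field_energy_def by (intro tendsto_intros d(3))
    show "exp (field_energy N b v g (\<lambda>i. d n (z i))) \<le>
      exp (b\<^sup>2 / \<delta> * ?s g) * exp (\<Sum>i<N. 0 * z i - (\<delta> / 2 - 1) / 2 * (z i)\<^sup>2)" for n g z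
      unfolding exp_add[symmetric] using ub by (simp only: exp_le_cancel_iff)
    show "{z \<in> space (gauss_vec N). ?s z \<le> R} \<in> sets (gauss_vec N)"
      using s_meas by measurable
    show "- (b\<^sup>2 * ?s g + (1 / 4 + \<bar>v\<bar> / 2) * R) \<le> field_energy N b v g (\<lambda>i. d n (z i))"
      if "z \<in> {z \<in> space (gauss_vec N). ?s z \<le> R}" for n g z
    proof -
      let ?z = "\<lambda>i. d n (z i)"
      have s: "?s ?z \<le> R" using sd[of n z] that by simp
      have "- field_energy N b v g ?z \<le> b\<^sup>2 * ?s g + (1 / 4 + \<bar>v\<bar> / 2) * ?s ?z"
        unfolding field_energy_def sum_distrib_left sum.distrib[symmetric] sum_negf[symmetric]
      proof (rule sum_mono)
        fix i
        \<comment> \<open>On the ball \<open>S\<close> no decay has to be saved, so parameter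
          \<open>1\<close> is good enough; it is the source of the constant \<open>1 / 4\<close> in
          \<open>L\<close>.\<close>
        have "- b * g i * ?z i \<le> b\<^sup>2 * (g i)\<^sup>2 + 1 / 4 * (?z i)\<^sup>2"
          using AM_GM_square[of 1 "- b * g i" "?z i"] by (simp add: power_mult_distrib)
        moreover have "v / 2 * (?z i)\<^sup>2 \<le> \<bar>v\<bar> / 2 * (?z i)\<^sup>2"
          by (intro mult_right_mono) auto
        ultimately show "- (b * g i * ?z i - v / 2 * (?z i)\<^sup>2) \<le> b\<^sup>2 * (g i)\<^sup>2 + (1 / 4 + \<bar>v\<bar> / 2) * (?z i)\<^sup>2"
          by (simp add: distrib_right)
      qed
      also have "\<dots> \<le> b\<^sup>2 * ?s g + (1 / 4 + \<bar>v\<bar> / 2) * R"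
        using s by (intro add_left_mono mult_left_mono) auto
      finally show ?thesis by simp
    qed
    show "integrable (gauss_vec N) (\<lambda>g. b\<^sup>2 / \<delta> * ?s g)"
      by (intro integrable_mult_right s_int)
    show "integrable (gauss_vec N) (\<lambda>g. b\<^sup>2 * ?s g + (1 / 4 + \<bar>v\<bar> / 2) * R)"
      by (intro Bochner_Integration.integrable_add integrable_mult_right s_int const)
  qed (use R H_int in \<open>auto intro: prob_space_gauss_vec\<close>)
qed

text \<open>Each one-site integral is the exponential of a multiple of the squared field, up to a
  constant factor. The logarithm is then affine in the squares \<open>(g i)\<^sup>2\<close>, and
  only their mean, one, is needed.\<close>

lemma expectation_ln_field_partition:
  assumes v: "v > - 1"
  shows "(\<integral>g. ln (\<integral>z. exp (field_energy N b v g z) \<partial>gauss_vec N) \<partial>gauss_vec N)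
    = real N * (ln (1 / sqrt (1 + v)) + b\<^sup>2 / (2 * (1 + v)))"
proof -
  let ?u = "1 + v"
  have u: "?u > 0" using v by simp
  have "(\<integral>z. exp (field_energy N b v g z) \<partial>gauss_vec N) = (\<Prod>i<N. 1 / sqrt ?u * exp ((b * g i)\<^sup>2 / (2 * ?u)))" for g
  proof -
    have "(\<integral>z. exp (field_energy N b v g z) \<partial>gauss_vec N) =
        (\<integral>z. (\<Prod>i<N. exp (b * g i * z i - (?u - 1) / 2 * (z i)\<^sup>2)) \<partial>PiM {..<N} (\<lambda>_. std_gauss))"
      unfolding field_energy_def gauss_vec_def by (simp add: exp_sum)
    also have "\<dots> = (\<Prod>i<N. \<integral>y. exp (b * g i * y - (?u - 1) / 2 * y\<^sup>2) \<partial>std_gauss)"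
      by (rule std_gauss_prod.product_integral_prod[OF finite_lessThan integrable_exp_std_gauss[OF u]])
    also have "\<dots> = (\<Prod>i<N. 1 / sqrt ?u * exp ((b * g i)\<^sup>2 / (2 * ?u)))"
      by (simp only: integral_exp_std_gauss[OF u])
    finally show ?thesis .
  qed
  moreover have "ln (1 / sqrt ?u * exp y) = ln (1 / sqrt ?u) + y" for y
    using u by (subst ln_mult) auto
  ultimately have ln: "ln (\<integral>z. exp (field_energy N b v g z) \<partial>gauss_vec N) =
      (\<Sum>i<N. ln (1 / sqrt ?u) + b\<^sup>2 / (2 * ?u) * (g i)\<^sup>2)" for g
    using u by (simp add: ln_prod power_mult_distrib del: times_divide_eq_left mult_1_left) simp
  have sq: "integrable (gauss_vec N) (\<lambda>g. (g i)\<^sup>2)" "(\<integral>g. (g i)\<^sup>2 \<partial>gauss_vec N) = 1" if "i < N" for i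
  proof -
    show "integrable (gauss_vec N) (\<lambda>g. (g i)\<^sup>2)"
      unfolding gauss_vec_def using that
      by (intro integrable_PiM_std_gauss_component[where f = "\<lambda>x. x\<^sup>2"] integrable_std_gauss_power) auto
    have "(\<integral>g. (g i)\<^sup>2 \<partial>gauss_vec N) = (\<integral>x. x\<^sup>2 \<partial>std_gauss)"
      unfolding gauss_vec_def using that by (intro integral_PiM_std_gauss_component[where f = "\<lambda>x. x\<^sup>2"]) auto
    also have "\<dots> = 1"
      unfolding std_gauss_def using std_normal_distribution_even_moments(1)[of 1] by simp
    finally show "(\<integral>g. (g i)\<^sup>2 \<partial>gauss_vec N) = 1" .
  qed
  interpret \<mu>: prob_space "gauss_vec N" by (rule prob_space_gauss_vec)
  have "(\<integral>g. (\<Sum>i<N. ln (1 / sqrt ?u) + b\<^sup>2 / (2 * ?u) * (g i)\<^sup>2) \<partial>gauss_vec N)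
      = (\<Sum>i<N. ln (1 / sqrt ?u) + b\<^sup>2 / (2 * ?u))"
    using sq by (subst Bochner_Integration.integral_sum) (auto simp: \<mu>.prob_space)
  then show ?thesis
    unfolding ln by simp
qed

lemma A_N_le_A_tilde:
  assumes N: "N \<ge> 1" and \<beta>: "\<beta> > 0" and q: "q \<in> D_set \<beta> lam"
  shows "A_N N \<beta> lam \<le> A_tilde \<beta> lam q"
proof -
  let ?b = "\<beta> * sqrt q" and ?v = "\<beta>\<^sup>2 * q - lam"
  \<comment> \<open>Membership in \<open>D_set\<close> is exactly what makes the field coefficient
    exceed \<open>- 1\<close>.\<close>
  have q0: "q \<ge> 0" and v: "?v > - 1" using q by (auto simp: D_set_def)
  obtain d :: "nat \<Rightarrow> real \<Rightarrow> real"
    where d: "\<And>n. d n \<in> borel_measurable borel" "\<And>n. finite (range (d n))"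
      "\<And>n z. \<bar>d n z\<bar> \<le> \<bar>z\<bar>" "\<And>z. (\<lambda>n. d n z) \<longlonglongrightarrow> z"
    using exists_simple_approximation by metis
  have "(\<integral>J. ln (Z_N N \<beta> lam J) \<partial>disorder N) = (\<integral>J. ln (\<integral>z. exp (energy N \<beta> lam J z) \<partial>gauss_vec N) \<partial>disorder N)"
    unfolding Z_N_def energy_def ..
  also have "\<dots> \<le> (\<integral>g. ln (\<integral>z. exp (field_energy N ?b ?v g z) \<partial>gauss_vec N) \<partial>gauss_vec N) + real N * (\<beta>\<^sup>2 / 4 * q\<^sup>2)"
    by (rule LIMSEQ_le[OF energy_limit[OF N \<beta> d(1,3,4)]
          tendsto_add[OF field_energy_limit[OF v d(1,3,4)] tendsto_const]])
      (use simple_comparison[OF N q0 d(1,2)] in blast)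
  also have "\<dots> = real N * (ln (1 / sqrt (1 + ?v)) + ?b\<^sup>2 / (2 * (1 + ?v)) + \<beta>\<^sup>2 / 4 * q\<^sup>2)"
    unfolding expectation_ln_field_partition[OF v] by (simp add: distrib_left)
  also have "ln (1 / sqrt (1 + ?v)) + ?b\<^sup>2 / (2 * (1 + ?v)) + \<beta>\<^sup>2 / 4 * q\<^sup>2 = A_tilde \<beta> lam q"
    unfolding A_tilde_def sigma_RS_def using q0 v
    by (simp add: power_divide power_mult_distrib algebra_simps)
  finally show ?thesis
    unfolding A_N_def using N by (simp add: field_simps)
qed

section \<open>The replica symmetric variational problem\<close>

text \<open>Here \<open>c\<close> stands for \<open>1 - lam\<close>, and \<open>q\<close> has been
  eliminated through \<open>\<beta>\<^sup>2 * q = u - c\<close>.\<close>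

definition RS_profile :: "real \<Rightarrow> real \<Rightarrow> real \<Rightarrow> real" where
  "RS_profile \<beta> c u = - 1/2 * ln u + (1 - c / u) / 2 + (u - c)\<^sup>2 / (4 * \<beta>\<^sup>2)"

lemma RS_profile_deriv:
  assumes "\<beta> > 0" "u > 0"
  shows "(RS_profile \<beta> c has_real_derivative (u - c) * (u - \<beta>) * ((u + \<beta>) / (2 * \<beta>\<^sup>2 * u\<^sup>2))) (at u)"
proof -
  have "(RS_profile \<beta> c has_real_derivative - 1/2 * (1 / u) + (c / u\<^sup>2) / 2 + 2 * (u - c) / (4 * \<beta>\<^sup>2)) (at u)"
    unfolding RS_profile_def[abs_def] using assms
    by (auto intro!: derivative_eq_intros simp: power2_eq_square) (simp add: field_simps)
  also have "- 1/2 * (1 / u) + (c / u\<^sup>2) / 2 + 2 * (u - c) / (4 * \<beta>\<^sup>2) =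
      (u - c) * (u - \<beta>) * ((u + \<beta>) / (2 * \<beta>\<^sup>2 * u\<^sup>2))"
    using assms by (simp add: divide_simps power2_eq_square) (simp add: algebra_simps)
  finally show ?thesis .
qed

text \<open>Since \<open>u \<ge> c\<close> reflects \<open>q \<ge> 0\<close>, the sign of the
  derivative is that of \<open>u - \<beta>\<close> throughout the admissible range. The minimum sits
  at \<open>\<beta>\<close> if this point is admissible and otherwise at the edge \<open>c\<close>,
  that is at \<open>q = 0\<close>: this is the origin of the two regimes.\<close>

lemma RS_profile_min:
  assumes \<beta>: "\<beta> > 0" and u: "u > 0" "u \<ge> c"
  shows "max c \<beta> \<le> u \<Longrightarrow> RS_profile \<beta> c (max c \<beta>) \<le> RS_profile \<beta> c u"
    and "u \<le> \<beta> \<Longrightarrow> RS_profile \<beta> c \<beta> \<le> RS_profile \<beta> c u"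
proof -
  show "RS_profile \<beta> c (max c \<beta>) \<le> RS_profile \<beta> c u" if "max c \<beta> \<le> u"
  proof (rule DERIV_nonneg_imp_nondecreasing[OF that])
    fix x assume x: "max c \<beta> \<le> x" "x \<le> u"
    then have "(x - c) * (x - \<beta>) * ((x + \<beta>) / (2 * \<beta>\<^sup>2 * x\<^sup>2)) \<ge> 0" "x > 0"
      using \<beta> by (auto intro!: mult_nonneg_nonneg divide_nonneg_nonneg)
    then show "\<exists>y. (RS_profile \<beta> c has_real_derivative y) (at x) \<and> 0 \<le> y"
      using RS_profile_deriv[OF \<beta>] by blast
  qed
  show "RS_profile \<beta> c \<beta> \<le> RS_profile \<beta> c u" if "u \<le> \<beta>"
  proof (rule DERIV_nonpos_imp_nonincreasing[OF that])
    fix x assume x: "u \<le> x" "x \<le> \<beta>"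
    have "(x - c) * (x - \<beta>) \<le> 0" "(x + \<beta>) / (2 * \<beta>\<^sup>2 * x\<^sup>2) \<ge> 0"
      using x \<beta> u by (auto intro!: mult_nonneg_nonpos divide_nonneg_nonneg)
    from mult_nonpos_nonneg[OF this]
    have "(x - c) * (x - \<beta>) * ((x + \<beta>) / (2 * \<beta>\<^sup>2 * x\<^sup>2)) \<le> 0" "x > 0"
      using x u by auto
    then show "\<exists>y. (RS_profile \<beta> c has_real_derivative y) (at x) \<and> y \<le> 0"
      using RS_profile_deriv[OF \<beta>] by blast
  qed
qed

lemma A_tilde_eq_profile:
  assumes \<beta>: "\<beta> > 0" and q: "q \<in> D_set \<beta> lam"
  shows "A_tilde \<beta> lam q = RS_profile \<beta> (1 - lam) (1 - lam + \<beta>\<^sup>2 * q)"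
proof -
  have u: "1 - lam + \<beta>\<^sup>2 * q > 0" using q by (simp add: D_set_def)
  have "ln (1 / sqrt (1 - lam + \<beta>\<^sup>2 * q)) = - 1/2 * ln (1 - lam + \<beta>\<^sup>2 * q)"
    using u by (simp add: ln_div ln_sqrt)
  moreover have "1/2 * \<beta>\<^sup>2 * q * (1 / sqrt (1 - lam + \<beta>\<^sup>2 * q))\<^sup>2 = (1 - (1 - lam) / (1 - lam + \<beta>\<^sup>2 * q)) / 2"
  proof -
    have "1 - (1 - lam) / (1 - lam + \<beta>\<^sup>2 * q) = (\<beta>\<^sup>2 * q) / (1 - lam + \<beta>\<^sup>2 * q)"
      using u by (simp add: diff_divide_eq_iff)
    then show ?thesis
      using u by (simp add: power_divide)
  qed
  moreover have "\<beta>\<^sup>2 / 4 * q\<^sup>2 = (\<beta>\<^sup>2 * q)\<^sup>2 / (4 * \<beta>\<^sup>2)"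
    using \<beta> by (simp add: power2_eq_square)
  ultimately show ?thesis
    unfolding A_tilde_def sigma_RS_def RS_profile_def by simp
qed

lemma A_RS_eq_min:
  assumes "q0 \<in> D_set \<beta> lam" "\<And>q. q \<in> D_set \<beta> lam \<Longrightarrow> A_tilde \<beta> lam q0 \<le> A_tilde \<beta> lam q"
  shows "A_RS \<beta> lam = A_tilde \<beta> lam q0"
  unfolding A_RS_def using assms by (intro cInf_eq_minimum) auto

lemma A_RS_high_temperature:
  assumes \<beta>: "\<beta> > 0" and lam: "lam < 1" "\<beta> \<le> 1 - lam"
  shows "0 \<in> D_set \<beta> lam" "A_RS \<beta> lam = A_tilde \<beta> lam 0" "A_tilde \<beta> lam 0 = - 1/2 * ln (1 - lam)"
proof -
  show D: "0 \<in> D_set \<beta> lam" using lam by (simp add: D_set_def)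
  show "A_RS \<beta> lam = A_tilde \<beta> lam 0"
  proof (rule A_RS_eq_min[OF D])
    fix q assume q: "q \<in> D_set \<beta> lam"
    then have "max (1 - lam) \<beta> \<le> 1 - lam + \<beta>\<^sup>2 * q" "0 < 1 - lam + \<beta>\<^sup>2 * q"
      using lam by (auto simp: D_set_def)
    from RS_profile_min(1)[OF \<beta> this(2) _ this(1)] this(1) show "A_tilde \<beta> lam 0 \<le> A_tilde \<beta> lam q"
      unfolding A_tilde_eq_profile[OF \<beta> q] A_tilde_eq_profile[OF \<beta> D] using lam by (simp add: max_def)
  qed
  show "A_tilde \<beta> lam 0 = - 1/2 * ln (1 - lam)"
    using lam by (simp add: A_tilde_def sigma_RS_def ln_div ln_sqrt)
qed

text \<open>\<open>q0\<close> is the solution of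
  \<open>1 - lam + \<beta>\<^sup>2 * q = \<beta>\<close>. The case \<open>lam \<ge> 1\<close> is
  included: the admissible \<open>u\<close> then fill the open half-line of positive numbers, which
  still contains \<open>\<beta>\<close>.\<close>

lemma A_RS_low_temperature:
  fixes \<beta> lam :: real
  defines "q0 \<equiv> (\<beta> - (1 - lam)) / \<beta>\<^sup>2"
  assumes \<beta>: "\<beta> > 0" and lam: "\<beta> > 1 - lam"
  shows "q0 \<in> D_set \<beta> lam" "A_RS \<beta> lam = A_tilde \<beta> lam q0"
    "A_tilde \<beta> lam q0 = - 1/2 * ln \<beta> + \<beta> * q0 / 2 + \<beta>\<^sup>2 * q0\<^sup>2 / 4"
proof -
  have q0: "\<beta>\<^sup>2 * q0 = \<beta> - (1 - lam)" "q0 \<ge> 0"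
    using \<beta> lam by (auto simp: q0_def)
  then have u: "1 - lam + \<beta>\<^sup>2 * q0 = \<beta>" by simp
  show D: "q0 \<in> D_set \<beta> lam" using q0 u \<beta> by (simp add: D_set_def)
  show "A_RS \<beta> lam = A_tilde \<beta> lam q0"
  proof (rule A_RS_eq_min[OF D])
    fix q assume q: "q \<in> D_set \<beta> lam"
    then have *: "0 < 1 - lam + \<beta>\<^sup>2 * q" "1 - lam \<le> 1 - lam + \<beta>\<^sup>2 * q"
      by (auto simp: D_set_def)
    show "A_tilde \<beta> lam q0 \<le> A_tilde \<beta> lam q"
      unfolding A_tilde_eq_profile[OF \<beta> q] A_tilde_eq_profile[OF \<beta> D] u
      using RS_profile_min[OF \<beta> *] lam by (cases "1 - lam + \<beta>\<^sup>2 * q \<le> \<beta>") (auto simp: max_def)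
  qed
  have "1/2 * \<beta>\<^sup>2 * q0 * (1 / sqrt \<beta>)\<^sup>2 = \<beta> * q0 / 2"
    using \<beta> by (simp add: power_divide power2_eq_square)
  then show "A_tilde \<beta> lam q0 = - 1/2 * ln \<beta> + \<beta> * q0 / 2 + \<beta>\<^sup>2 * q0\<^sup>2 / 4"
    unfolding A_tilde_def sigma_RS_def u using \<beta> by (simp add: ln_div ln_sqrt)
qed

theorem mainTheorem10:
  fixes \<beta> lam :: real
  assumes "\<beta> > 0"
  defines "qstar \<equiv> (\<beta> - (1 - lam)) / \<beta>\<^sup>2"
  shows "(lam < 1 \<and> \<beta> \<le> 1 - lam \<longrightarrow>
            A_RS \<beta> lam = - 1/2 * ln (1 - lam) \<and> 0 \<in> D_set \<beta> lam \<and> A_tilde \<beta> lam 0 = A_RS \<beta> lam)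
       \<and> (\<beta> > 1 - lam \<longrightarrow>
            A_RS \<beta> lam = - 1/2 * ln \<beta> + \<beta> * qstar / 2 + \<beta>\<^sup>2 * qstar\<^sup>2 / 4
            \<and> qstar \<in> D_set \<beta> lam \<and> A_tilde \<beta> lam qstar = A_RS \<beta> lam)
       \<and> (\<forall>N::nat. N \<ge> 1 \<longrightarrow> A_N N \<beta> lam \<le> A_RS \<beta> lam)"
proof -
  note high = A_RS_high_temperature[OF assms(1)]
  note low = A_RS_low_temperature[OF assms(1), of lam, folded qstar_def]
  have "A_N N \<beta> lam \<le> A_RS \<beta> lam" if "N \<ge> 1" for N
  proof -
    \<comment> \<open>The infimum is meaningful only over a non-empty set. The two regimes are
      exhaustive, because \<open>\<beta> \<le> 1 - lam\<close> together with
      \<open>\<beta> > 0\<close> forces \<open>lam < 1\<close>.\<close>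
    have "D_set \<beta> lam \<noteq> {}"
      using low(1) high(1)[of lam] assms(1) by (cases "\<beta> > 1 - lam") auto
    then show ?thesis
      unfolding A_RS_def using A_N_le_A_tilde[OF that assms(1)] by (intro cINF_greatest) auto
  qed
  then show ?thesis
    using high low by auto
qed

end
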